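(* Let $\mu_0$ be an integrable probability measure on $\mathbb{R}$ and let $(B_t)_{t\ge0}$ be a Brownian motion with $B_0\sim\mu_0$. Let $f_1,f_2,\ldots$ be a sequence of linear (i.e. affine) functions on $\mathbb{R}$ such that $|f_n'(x)|\le1$, and let $$g(x)=\inf_{n\in\mathbb{N}}f_n(x)\wedge u_{\mu_0}(x).$$ Set $T_0=0$, $g_0(x)=u_{\mu_0}(x)$ and, for $n\ge1$, define $$a_n=\inf\{x\in\mathbb{R}:f_n(x)<g_{n-1}(x)\},\qquad b_n=\sup\{x\in\mathbb{R}:f_n(x)<g_{n-1}(x)\},$$ $$T_n=\inf\{t\ge T_{n-1}:B_t\notin(a_n,b_n)\},\qquad g_n(x)=g_{n-1}(x)\wedge f_n(x).$$ Then the $T_n$ are increasing, so one may define $T=\lim_{n\to\infty}T_n$. If $$g(x)=u_\mu(x)-C\quad\text{for all }x\in\mathbb{R}$$ for some $C\in\mathbb{R}$ and some integrable probability measure $\mu$, then $T<\infty$ a.s. and $T$ is an embedding of $\mu$, i.e. $B_T\sim\mu$.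
   Context: $B$ is a one-dimensional Brownian motion. A measure $\mu$ is integrable if $\int|x|\,\mu(dx)<\infty$. For an integrable probability measure $\mu$ on $\mathbb{R}$, its potential is $u_\mu(x)=-\int|x-y|\,\mu(dy)$. Conventions: $\inf\emptyset=+\infty$, $\sup\emptyset=-\infty$, and $(a,b)=\emptyset$ if $a\ge b$ (so $T_n=T_{n-1}$ when $f_n\ge g_{n-1}$ everywhere); $a_n=-\infty$ or $b_n=+\infty$ is allowed. *)

theory Defs
  imports "HOL-Probability.Probability"
begin

definition integrable_prob :: "real measure \<Rightarrow> bool" where
  "integrable_prob \<mu> \<longleftrightarrow> real_distribution \<mu> \<and> integrable \<mu> (\<lambda>x. \<bar>x\<bar>)"

definition potential :: "real measure \<Rightarrow> real \<Rightarrow> real" where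
  "potential \<mu> x = - (\<integral>y. \<bar>x - y\<bar> \<partial>\<mu>)"

definition past_events :: "'a measure \<Rightarrow> (real \<Rightarrow> 'a \<Rightarrow> real) \<Rightarrow> real \<Rightarrow> 'a set set" where
  "past_events M B s =
     sigma_sets (space M) (\<Union>u\<in>{0..s}. {B u -` A \<inter> space M |A. A \<in> sets borel})"

text \<open>
  One-dimensional Brownian motion indexed by the times \<open>t \<ge> 0\<close>, with respect to its natural
  filtration and with every path continuous. The initial law is arbitrary; independence of
  \<open>B 0\<close> and the increments is contained in \<open>indep_increments\<close>, because \<open>B 0\<close> is measurable
  with respect to each \<open>past_events M B s\<close>. Values of \<open>B\<close> at negative times are irrelevant.
\<close>

locale brownian_motion = prob_space M
  for M :: "'a measure" and B :: "real \<Rightarrow> 'a \<Rightarrow> real" +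
  assumes random_variable_B: "\<And>t. 0 \<le> t \<Longrightarrow> random_variable borel (B t)"
    and continuous_paths: "\<And>\<omega>. \<omega> \<in> space M \<Longrightarrow> continuous_on {0..} (\<lambda>t. B t \<omega>)"
    and normal_increments: "\<And>s t. 0 \<le> s \<Longrightarrow> s < t \<Longrightarrow>
      distributed M lborel (\<lambda>\<omega>. B t \<omega> - B s \<omega>) (normal_density 0 (sqrt (t - s)))"
    and indep_increments: "\<And>s t. 0 \<le> s \<Longrightarrow> s < t \<Longrightarrow>
      indep_set (past_events M B s)
        {(\<lambda>\<omega>. B t \<omega> - B s \<omega>) -` A \<inter> space M |A. A \<in> sets borel}"

text \<open>
  The sequence of affine functions is \<open>f 1, f 2, \<dots>\<close>; the value \<open>f 0\<close> is never used.
  Throughout, \<open>u\<close> is the starting potential.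
\<close>

primrec g_seq :: "(real \<Rightarrow> real) \<Rightarrow> (nat \<Rightarrow> real \<Rightarrow> real) \<Rightarrow> nat \<Rightarrow> real \<Rightarrow> real" where
  "g_seq u f 0 = u"
| "g_seq u f (Suc n) = (\<lambda>x. min (g_seq u f n x) (f (Suc n) x))"

text \<open>The infimum is taken in the extended reals, so that it may be \<open>- \<infinity>\<close>.\<close>

definition g_inf :: "(real \<Rightarrow> real) \<Rightarrow> (nat \<Rightarrow> real \<Rightarrow> real) \<Rightarrow> real \<Rightarrow> ereal" where
  "g_inf u f x = min (INF n\<in>{1..}. ereal (f n x)) (ereal (u x))"

text \<open>
  Infima and suprema in \<^typ>\<open>ereal\<close> give \<open>Inf {} = \<infinity>\<close> and \<open>Sup {} = - \<infinity>\<close>.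
\<close>

definition left_end :: "(real \<Rightarrow> real) \<Rightarrow> (nat \<Rightarrow> real \<Rightarrow> real) \<Rightarrow> nat \<Rightarrow> ereal" where
  "left_end u f n = Inf (ereal ` {x. f n x < g_seq u f (n - 1) x})"

definition right_end :: "(real \<Rightarrow> real) \<Rightarrow> (nat \<Rightarrow> real \<Rightarrow> real) \<Rightarrow> nat \<Rightarrow> ereal" where
  "right_end u f n = Sup (ereal ` {x. f n x < g_seq u f (n - 1) x})"

primrec exit_time ::
  "(real \<Rightarrow> 'a \<Rightarrow> real) \<Rightarrow> (real \<Rightarrow> real) \<Rightarrow> (nat \<Rightarrow> real \<Rightarrow> real) \<Rightarrow> nat \<Rightarrow> 'a \<Rightarrow> ereal"
where
  "exit_time B u f 0 = (\<lambda>\<omega>. 0)"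
| "exit_time B u f (Suc n) = (\<lambda>\<omega>. Inf (ereal ` {t. 0 \<le> t \<and> exit_time B u f n \<omega> \<le> ereal t \<and>
     ereal (B t \<omega>) \<notin> {left_end u f (Suc n)<..<right_end u f (Suc n)}}))"

definition limit_time ::
  "(real \<Rightarrow> 'a \<Rightarrow> real) \<Rightarrow> (real \<Rightarrow> real) \<Rightarrow> (nat \<Rightarrow> real \<Rightarrow> real) \<Rightarrow> 'a \<Rightarrow> ereal"
where
  "limit_time B u f \<omega> = lim (\<lambda>n. exit_time B u f n \<omega>)"

text \<open>
  \<open>B\<^sub>T\<close> has law \<open>\<mu>\<close>. This is only meaningful for almost surely finite \<open>T\<close>: where \<open>T = \<infinity>\<close>,
  \<^const>\<open>real_of_ereal\<close> returns the dummy value \<open>0\<close>.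
\<close>

definition embeds ::
  "'a measure \<Rightarrow> (real \<Rightarrow> 'a \<Rightarrow> real) \<Rightarrow> ('a \<Rightarrow> ereal) \<Rightarrow> real measure \<Rightarrow> bool"
where
  "embeds M B T \<mu> \<longleftrightarrow>
     (\<lambda>\<omega>. B (real_of_ereal (T \<omega>)) \<omega>) \<in> borel_measurable M \<and>
     distr M borel (\<lambda>\<omega>. B (real_of_ereal (T \<omega>)) \<omega>) = \<mu>"

end

theory Submission
  imports Defs
begin

text \<open>
  Write \<open>B(t, n)\<close> for \<open>B\<close> stopped at \<open>T\<^sub>n \<and> t\<close>, and let \<open>J\<close> be the open interval on which
  \<open>f\<^sub>n < g\<^sub>n\<^sub>-\<^sub>1\<close>. Between \<open>T\<^sub>n\<^sub>-\<^sub>1\<close> and \<open>T\<^sub>n\<close> the path stays in the closure of \<open>J\<close>, where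
  \<open>\<bar>y - x\<bar>\<close> is affine in \<open>y\<close> if \<open>x \<notin> J\<close>; optional stopping at bounded times therefore leaves
  \<open>E \<bar>B(t, n) - x\<bar>\<close> unchanged in this step. Inside \<open>J\<close> this function of \<open>x\<close> is controlled by convexity if
  \<open>J\<close> is bounded and by its Lipschitz constant \<open>1\<close> if \<open>J\<close> is a half-line, as \<open>f\<^sub>n\<close> then has slope
  \<open>1\<close> or \<open>- 1\<close>. So \<open>E \<bar>B(t, n) - x\<bar> \<le> - g\<^sub>n(x) \<le> - g(x)\<close>, and Fatou gives the same bound for
  \<open>B\<close> stopped at \<open>T \<and> t\<close>. As \<open>B\<^sub>t\<close> leaves every bounded set in probability, \<open>T < \<infinity>\<close> almost surely.

  The same comparison at the times \<open>T\<^sub>n\<close> themselves shows that the potential of the law of \<open>B\<close> at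
  \<open>T\<^sub>n\<close> is \<open>g\<^sub>n\<close> up to an additive constant: for bounded \<open>J\<close> the means at \<open>T\<^sub>n\<^sub>-\<^sub>1\<close> and \<open>T\<^sub>n\<close>
  agree, whereas for a half-line with endpoint \<open>b\<close> the value is just the maximum or the minimum of the
  previous one and \<open>b\<close>. The constants disappear in the differences
  \<open>\<bar>y - (x + h)\<bar> - \<bar>y - x\<bar>\<close>, which are bounded in \<open>y\<close>, so their integrals converge along \<open>T\<^sub>n \<rightarrow> T\<close>
  and identify the law of \<open>B\<^sub>T\<close> with \<open>\<mu>\<close>; letting \<open>h \<rightarrow> 0\<close> recovers the distribution function.
\<close>

section \<open>Optional stopping at bounded times\<close>

text \<open>Fatou's lemma for the absolute values; it carries first moment bounds from stopped paths
  to their limit.\<close>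

lemma integrable_abs_of_tendsto:
  fixes X :: "nat \<Rightarrow> 'a \<Rightarrow> real"
  assumes X: "\<And>n. integrable M (X n)" and Y: "Y \<in> borel_measurable M"
    and lim: "AE \<omega> in M. (\<lambda>n. X n \<omega>) \<longlonglongrightarrow> Y \<omega>"
    and bound: "\<And>n. (\<integral>\<omega>. \<bar>X n \<omega>\<bar> \<partial>M) \<le> c"
  shows "integrable M Y" and "(\<integral>\<omega>. \<bar>Y \<omega>\<bar> \<partial>M) \<le> c"
proof -
  have [measurable]: "X n \<in> borel_measurable M" for n
    using X by auto
  have c: "0 \<le> c"
    by (rule order_trans[OF _ bound[of 0]]) simp
  have "(\<integral>\<^sup>+\<omega>. ennreal \<bar>Y \<omega>\<bar> \<partial>M) = (\<integral>\<^sup>+\<omega>. liminf (\<lambda>n. ennreal \<bar>X n \<omega>\<bar>) \<partial>M)"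
  proof (rule nn_integral_cong_AE)
    show "AE \<omega> in M. ennreal \<bar>Y \<omega>\<bar> = liminf (\<lambda>n. ennreal \<bar>X n \<omega>\<bar>)"
      using lim
    proof eventually_elim
      case (elim \<omega>)
      then have "(\<lambda>n. ennreal \<bar>X n \<omega>\<bar>) \<longlonglongrightarrow> ennreal \<bar>Y \<omega>\<bar>"
        by (intro tendsto_ennrealI tendsto_rabs)
      then show ?case
        by (intro lim_imp_Liminf[symmetric]) simp_all
    qed
  qed
  also have "\<dots> \<le> liminf (\<lambda>n. \<integral>\<^sup>+\<omega>. ennreal \<bar>X n \<omega>\<bar> \<partial>M)"
    by (rule nn_integral_liminf) measurable
  also have "\<dots> \<le> liminf (\<lambda>n::nat. ennreal c)"
    by (intro Liminf_mono always_eventually allI)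
      (use X bound in \<open>simp add: nn_integral_eq_integral ennreal_leI\<close>)
  finally have le: "(\<integral>\<^sup>+\<omega>. ennreal \<bar>Y \<omega>\<bar> \<partial>M) \<le> ennreal c"
    by (simp add: Liminf_const)
  show I: "integrable M Y"
    using Y le by (intro integrableI_bounded) (auto simp: le_less_trans ennreal_less_top)
  have "(\<integral>\<^sup>+\<omega>. ennreal \<bar>Y \<omega>\<bar> \<partial>M) = ennreal (\<integral>\<omega>. \<bar>Y \<omega>\<bar> \<partial>M)"
    using I by (intro nn_integral_eq_integral) auto
  with le c show "(\<integral>\<omega>. \<bar>Y \<omega>\<bar> \<partial>M) \<le> c"
    by simp
qed

text \<open>Bounded second moments act as uniform integrability: clamping \<open>X n\<close> at
  level \<open>K\<close> moves its mean by at most \<open>c / K\<close>, uniformly in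
  \<open>n\<close>. The clamped means converge boundedly, so the clamped mean of \<open>Y\<close> is
  at most \<open>c / K\<close> in absolute value, and \<open>K\<close> tends to infinity.\<close>

lemma (in prob_space) expectation_zero_of_L2_bounded:
  fixes X :: "nat \<Rightarrow> 'a \<Rightarrow> real"
  assumes X: "\<And>n. integrable M (X n)" and sq: "\<And>n. integrable M (\<lambda>\<omega>. (X n \<omega>)\<^sup>2)"
    and zero: "\<And>n. expectation (X n) = 0" and bound: "\<And>n. expectation (\<lambda>\<omega>. (X n \<omega>)\<^sup>2) \<le> c"
    and Y: "Y \<in> borel_measurable M"
    and lim: "\<And>\<omega>. \<omega> \<in> space M \<Longrightarrow> (\<lambda>n. X n \<omega>) \<longlonglongrightarrow> Y \<omega>"
  shows "integrable M Y" and "expectation Y = 0"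
proof -
  have [measurable]: "X n \<in> borel_measurable M" for n
    using X by auto
  note [measurable] = Y
  have L1: "expectation (\<lambda>\<omega>. \<bar>X n \<omega>\<bar>) \<le> 1 + c" for n
  proof -
    have "\<bar>x\<bar> \<le> 1 + x\<^sup>2" for x :: real
    proof (cases "\<bar>x\<bar> \<le> 1")
      case False
      then have "\<bar>x\<bar> * 1 \<le> \<bar>x\<bar> * \<bar>x\<bar>"
        by (intro mult_left_mono) auto
      then show ?thesis
        by (simp add: power2_eq_square)
    qed (auto intro: add_increasing2)
    then have "expectation (\<lambda>\<omega>. \<bar>X n \<omega>\<bar>) \<le> expectation (\<lambda>\<omega>. 1 + (X n \<omega>)\<^sup>2)"
      by (intro integral_mono) (use X sq in auto)
    also have "\<dots> \<le> 1 + c"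
      using sq bound by (simp add: prob_space)
    finally show ?thesis .
  qed
  show I: "integrable M Y"
    by (rule integrable_abs_of_tendsto(1)[where X=X, OF X Y _ L1]) (simp add: lim)
  define clamp :: "real \<Rightarrow> real \<Rightarrow> real" where "clamp K x = max (-K) (min K x)" for K x
  have clamp_meas[measurable]: "clamp K \<in> borel_measurable borel" for K
    unfolding clamp_def by measurable
  have clamp_abs: "\<bar>clamp K x\<bar> \<le> K" "\<bar>clamp K x\<bar> \<le> \<bar>x\<bar>" if "K > 0" for K x
    using that by (auto simp: clamp_def)
  \<comment> \<open>Clamping changes only values beyond \<open>K\<close>, and there \<bar>x\<bar> is
    at most \<open>x\<^sup>2 / K\<close>.\<close>
  have clamp_err: "\<bar>clamp K x - x\<bar> \<le> x\<^sup>2 / K" if "K > 0" for K x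
  proof (cases "\<bar>x\<bar> \<le> K")
    case False
    then have "\<bar>clamp K x - x\<bar> \<le> \<bar>x\<bar>"
      using that by (auto simp: clamp_def)
    also have "\<bar>x\<bar> \<le> x\<^sup>2 / K"
    proof -
      have "\<bar>x\<bar> * K \<le> \<bar>x\<bar> * \<bar>x\<bar>"
        using False by (intro mult_left_mono) auto
      then show ?thesis
        using that by (simp add: field_simps power2_eq_square)
    qed
    finally show ?thesis .
  qed (use that in \<open>auto simp: clamp_def\<close>)
  have small: "\<bar>expectation (\<lambda>\<omega>. clamp K (Y \<omega>))\<bar> \<le> c / K" if "K > 0" for K
  proof -
    have "(\<lambda>n. expectation (\<lambda>\<omega>. clamp K (X n \<omega>))) \<longlonglongrightarrow> expectation (\<lambda>\<omega>. clamp K (Y \<omega>))"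
    proof (rule integral_dominated_convergence[where w="\<lambda>_. K"])
      show "AE \<omega> in M. (\<lambda>n. clamp K (X n \<omega>)) \<longlonglongrightarrow> clamp K (Y \<omega>)"
        using lim by (intro AE_I2) (auto simp: clamp_def intro!: tendsto_intros)
    qed (use clamp_abs that in auto)
    moreover have "\<bar>expectation (\<lambda>\<omega>. clamp K (X n \<omega>))\<bar> \<le> c / K" for n
    proof -
      have Ic: "integrable M (\<lambda>\<omega>. clamp K (X n \<omega>))"
        by (rule integrable_const_bound[where B=K]) (use clamp_abs that in auto)
      have "expectation (\<lambda>\<omega>. clamp K (X n \<omega>)) = expectation (\<lambda>\<omega>. clamp K (X n \<omega>) - X n \<omega>)"
        using Ic X zero by simp
      also have "\<bar>\<dots>\<bar> \<le> expectation (\<lambda>\<omega>. \<bar>clamp K (X n \<omega>) - X n \<omega>\<bar>)"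
        by (rule integral_abs_bound)
      also have "\<dots> \<le> expectation (\<lambda>\<omega>. (X n \<omega>)\<^sup>2 / K)"
        by (intro integral_mono) (use clamp_err that Ic X sq in auto)
      also have "\<dots> \<le> c / K"
        using bound that by (simp add: divide_right_mono)
      finally show ?thesis .
    qed
    ultimately show ?thesis
      by (intro LIMSEQ_le_const2[OF tendsto_rabs]) auto
  qed
  have "(\<lambda>n. expectation (\<lambda>\<omega>. clamp (real (Suc n)) (Y \<omega>))) \<longlonglongrightarrow> expectation Y"
  proof (rule integral_dominated_convergence[where w="\<lambda>\<omega>. \<bar>Y \<omega>\<bar>"])
    show "AE \<omega> in M. (\<lambda>n. clamp (real (Suc n)) (Y \<omega>)) \<longlonglongrightarrow> Y \<omega>"
    proof (intro AE_I2 tendsto_eventually)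
      fix \<omega>
      obtain N where "\<bar>Y \<omega>\<bar> \<le> real N"
        using real_arch_simple by blast
      then show "\<forall>\<^sub>F n in sequentially. clamp (real (Suc n)) (Y \<omega>) = Y \<omega>"
        by (intro eventually_sequentiallyI[of N]) (auto simp: clamp_def)
    qed
    show "AE \<omega> in M. norm (clamp (real (Suc n)) (Y \<omega>)) \<le> \<bar>Y \<omega>\<bar>" for n
      using clamp_abs[of "real (Suc n)"] by auto
  qed (use I in auto)
  moreover have "(\<lambda>n. expectation (\<lambda>\<omega>. clamp (real (Suc n)) (Y \<omega>))) \<longlonglongrightarrow> 0"
  proof (rule Lim_null_comparison)
    show "\<forall>\<^sub>F n in sequentially. norm (expectation (\<lambda>\<omega>. clamp (real (Suc n)) (Y \<omega>))) \<le> c / real (Suc n)"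
      using small by (intro always_eventually allI) auto
    show "(\<lambda>n. c / real (Suc n)) \<longlonglongrightarrow> 0"
      using LIMSEQ_Suc[OF lim_const_over_n[of c]] by simp
  qed
  ultimately show "expectation Y = 0"
    using LIMSEQ_unique by blast
qed

section \<open>Natural filtration, increments and the walk on a grid\<close>

context brownian_motion
begin

text \<open>The sigma-algebra \<open>past_events M B s\<close> packaged as a measure, so that being
  known at time \<open>s\<close> becomes measurability from \<open>past s\<close>.\<close>

definition past :: "real \<Rightarrow> 'a measure" where
  "past s = sigma (space M) (\<Union>u\<in>{0..s}. {B u -` A \<inter> space M |A. A \<in> sets borel})"

lemma space_past [simp]: "space (past s) = space M"
  and sets_past: "sets (past s) = past_events M B s"
  unfolding past_def past_events_def
  by (subst space_measure_of sets_measure_of; auto)+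

lemma measurable_past: "0 \<le> u \<Longrightarrow> u \<le> s \<Longrightarrow> B u \<in> borel_measurable (past s)"
  by (rule measurableI) (fastforce simp: sets_past past_events_def intro!: sigma_sets.Basic)+

lemma past_mono: "r \<le> s \<Longrightarrow> sets (past r) \<subseteq> sets (past s)"
  unfolding sets_past past_events_def by (intro sigma_sets_mono' UN_mono) auto

lemma past_subset: "sets (past s) \<subseteq> sets M"
  unfolding sets_past past_events_def
  by (intro sets.sigma_sets_subset) (use random_variable_B in \<open>auto intro: measurable_sets\<close>)

lemma measurable_past_imp: "X \<in> borel_measurable (past s) \<Longrightarrow> X \<in> borel_measurable M"
  by (rule measurable_mono[THEN subsetD, of borel borel "past s" M]) (use past_subset in auto)

lemma measurable_past_mono:
  "X \<in> borel_measurable (past r) \<Longrightarrow> r \<le> s \<Longrightarrow> X \<in> borel_measurable (past s)"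
  by (rule measurable_mono[THEN subsetD, of borel borel "past r" "past s"])
    (use past_mono in auto)

text \<open>The preimage systems of \<open>X\<close> and of the increment are stable under
  intersections, so independence of these systems extends to the sigma-algebras they generate, which
  is what \<open>indep_var\<close> demands.\<close>

lemma indep_past_increment:
  assumes X: "X \<in> borel_measurable (past s)" and st: "0 \<le> s" "s < t"
  shows "indep_var borel X borel (\<lambda>\<omega>. B t \<omega> - B s \<omega>)"
proof -
  let ?D = "\<lambda>\<omega>. B t \<omega> - B s \<omega>"
  let ?G = "{?D -` A \<inter> space M |A. A \<in> sets borel}"
  let ?X = "{X -` A \<inter> space M |A. A \<in> sets borel}"
  have Int_stable: "Int_stable {Z -` A \<inter> space M |A. A \<in> sets borel}" for Z :: "'a \<Rightarrow> real"
  proof (rule Int_stableI)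
    fix a b
    assume "a \<in> {Z -` A \<inter> space M |A. A \<in> sets borel}" "b \<in> {Z -` A \<inter> space M |A. A \<in> sets borel}"
    then obtain A B where "A \<in> sets borel" "a = Z -` A \<inter> space M" "B \<in> sets borel"
      "b = Z -` B \<inter> space M"
      by auto
    then show "a \<inter> b \<in> {Z -` A \<inter> space M |A. A \<in> sets borel}"
      by (intro CollectI exI[of _ "A \<inter> B"]) auto
  qed
  have "?X \<subseteq> past_events M B s"
    using measurable_sets[OF X] by (auto simp: sets_past)
  with indep_increments[OF st] have "indep_set ?X ?G"
    unfolding indep_sets2_eq by blast
  from indep_set_sigma_sets[OF this Int_stable Int_stable] show ?thesis
    unfolding indep_var_eq
    using measurable_past_imp[OF X] random_variable_B[of s] random_variable_B[of t] st by auto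
qed

lemma
  assumes st: "0 \<le> s" "s < t"
  shows integrable_increment: "integrable M (\<lambda>\<omega>. B t \<omega> - B s \<omega>)"
    and integrable_increment_square: "integrable M (\<lambda>\<omega>. (B t \<omega> - B s \<omega>)\<^sup>2)"
    and expectation_increment: "expectation (\<lambda>\<omega>. B t \<omega> - B s \<omega>) = 0"
    and expectation_increment_square: "expectation (\<lambda>\<omega>. (B t \<omega> - B s \<omega>)\<^sup>2) = t - s"
proof -
  have pos: "0 < sqrt (t - s)"
    using st by simp
  note D = normal_increments[OF st]
  show "integrable M (\<lambda>\<omega>. B t \<omega> - B s \<omega>)"
    using integrable_normal_moment_nz_1[OF pos, of 0] by (intro distributed_integrable_var[OF D]) auto
  show "integrable M (\<lambda>\<omega>. (B t \<omega> - B s \<omega>)\<^sup>2)"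
    using integrable_normal_moment[OF pos, of 0 2] distributed_integrable[OF D, of "\<lambda>x. x\<^sup>2"] by simp
  show E: "expectation (\<lambda>\<omega>. B t \<omega> - B s \<omega>) = 0"
    by (rule normal_distributed_expectation[OF pos D])
  show "expectation (\<lambda>\<omega>. (B t \<omega> - B s \<omega>)\<^sup>2) = t - s"
    using normal_distributed_variance[OF pos D] st unfolding E by simp
qed

text \<open>The normal density is bounded by its value at the mean, and the interval has length
  \<open>2 * K\<close>. As \<open>t\<close> grows the bound tends to 0, which drives
  \<open>B\<close> out of bounded sets in probability.\<close>

lemma prob_increment_small:
  assumes st: "0 \<le> s" "s < t" and K: "0 \<le> K"
  shows "prob {\<omega> \<in> space M. \<bar>B t \<omega> - B s \<omega>\<bar> \<le> K} \<le> 2 * K / sqrt (2 * pi * (t - s))"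
proof -
  let ?c = "1 / sqrt (2 * pi * (t - s))"
  have le: "normal_density 0 (sqrt (t - s)) x \<le> ?c" for x
    using st by (simp add: normal_density_def divide_simps)
  have eq: "{\<omega> \<in> space M. \<bar>B t \<omega> - B s \<omega>\<bar> \<le> K} = (\<lambda>\<omega>. B t \<omega> - B s \<omega>) -` {-K..K} \<inter> space M"
    by auto
  have "emeasure M {\<omega> \<in> space M. \<bar>B t \<omega> - B s \<omega>\<bar> \<le> K} =
    (\<integral>\<^sup>+x. ennreal (normal_density 0 (sqrt (t - s)) x) * indicator {-K..K} x \<partial>lborel)"
    unfolding eq by (rule distributed_emeasure[OF normal_increments[OF st]]) simp
  also have "\<dots> \<le> (\<integral>\<^sup>+x. ennreal ?c * indicator {-K..K} x \<partial>lborel)"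
    using le by (intro nn_integral_mono mult_right_mono ennreal_leI) auto
  also have "\<dots> = ennreal ?c * emeasure lborel {-K..K}"
    by (subst nn_integral_cmult_indicator) auto
  also have "\<dots> = ennreal ?c * ennreal (2 * K)"
    using K by simp
  also have "\<dots> = ennreal (2 * K / sqrt (2 * pi * (t - s)))"
    using st K by (subst ennreal_mult[symmetric]) (auto simp: mult.commute)
  finally show ?thesis
    using st K by (simp add: emeasure_eq_measure)
qed


text \<open>The walk is the discretisation of \<open>B\<close> on the grid of mesh \<open>1 / k\<close>, stopped at the
  first grid point not before \<open>r\<close>.\<close>

lemma stopped_walk:
  fixes r :: "'a \<Rightarrow> real" and k :: nat
  assumes k: "0 < k" and r: "\<And>s. 0 \<le> s \<Longrightarrow> {\<omega> \<in> space M. r \<omega> \<le> s} \<in> sets (past s)"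
  defines "W \<equiv> \<lambda>m \<omega>. \<Sum>j<m. if real j / real k < r \<omega>
             then B (real (Suc j) / real k) \<omega> - B (real j / real k) \<omega> else 0"
  shows "W m \<in> borel_measurable (past (real m / real k)) \<and> integrable M (W m) \<and>
    integrable M (\<lambda>\<omega>. (W m \<omega>)\<^sup>2) \<and> expectation (W m) = 0 \<and>
    expectation (\<lambda>\<omega>. (W m \<omega>)\<^sup>2) \<le> real m / real k"
proof (induction m)
  case 0
  then show ?case
    by (simp add: W_def)
next
  case (Suc m)
  let ?s = "real m / real k" and ?t = "real (Suc m) / real k"
  have st: "0 \<le> ?s" "?s < ?t" "0 \<le> ?t" "?t - ?s = 1 / real k"
    using k by (auto simp: field_simps)
  define D where "D \<omega> = B ?t \<omega> - B ?s \<omega>" for \<omega>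
  \<comment> \<open>\<open>I\<close> decides whether the step after \<open>?s\<close> is taken. The
    hypothesis on \<open>r\<close> makes this decision known at time \<open>?s\<close>, hence
    independent of the increment \<open>D\<close>.\<close>
  define I where "I \<omega> = (if ?s < r \<omega> then 1 else 0 :: real)" for \<omega>
  have D: "integrable M D" "integrable M (\<lambda>\<omega>. (D \<omega>)\<^sup>2)" "expectation D = 0"
    "expectation (\<lambda>\<omega>. (D \<omega>)\<^sup>2) = 1 / real k"
    using integrable_increment[OF st(1,2)] integrable_increment_square[OF st(1,2)]
      expectation_increment[OF st(1,2)] expectation_increment_square[OF st(1,2)] st(4)
    unfolding D_def by simp_all
  have W_Suc: "W (Suc m) = (\<lambda>\<omega>. W m \<omega> + I \<omega> * D \<omega>)"
    by (auto simp: W_def D_def I_def)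
  have W: "W m \<in> borel_measurable (past ?s)" "integrable M (W m)"
    "integrable M (\<lambda>\<omega>. (W m \<omega>)\<^sup>2)" "expectation (W m) = 0"
    "expectation (\<lambda>\<omega>. (W m \<omega>)\<^sup>2) \<le> ?s"
    using Suc by auto
  have "{\<omega> \<in> space (past ?s). ?s < r \<omega>} = space (past ?s) - {\<omega> \<in> space M. r \<omega> \<le> ?s}"
    by auto
  also have "\<dots> \<in> sets (past ?s)"
    using r[OF st(1)] by blast
  finally have I_past: "I \<in> borel_measurable (past ?s)"
    unfolding I_def by (intro measurable_If) auto
  have I_meas: "I \<in> borel_measurable M"
    by (rule measurable_past_imp[OF I_past])
  have I_int: "integrable M I"
    by (rule integrable_const_bound[where B=1]) (use I_meas in \<open>auto simp: I_def\<close>)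
  have WI_past: "(\<lambda>\<omega>. W m \<omega> * I \<omega>) \<in> borel_measurable (past ?s)"
    using W(1) I_past by measurable
  have WI_int: "integrable M (\<lambda>\<omega>. W m \<omega> * I \<omega>)"
    by (rule Bochner_Integration.integrable_bound[OF W(2)])
      (use measurable_past_imp[OF WI_past] in \<open>auto simp: I_def\<close>)
  note indep = indep_past_increment[OF _ st(1,2), folded D_def]
  have indep_I: "indep_var borel I borel D" and indep_WI: "indep_var borel (\<lambda>\<omega>. W m \<omega> * I \<omega>) borel D"
    using indep[OF I_past] indep[OF WI_past] by (simp_all add: D_def[abs_def])
  have ID: "integrable M (\<lambda>\<omega>. I \<omega> * D \<omega>)" "expectation (\<lambda>\<omega>. I \<omega> * D \<omega>) = 0"
    using indep_var_integrable[OF indep_I I_int D(1)]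
      indep_var_lebesgue_integral[OF indep_I I_int D(1)] D(3) by auto
  have WID: "integrable M (\<lambda>\<omega>. (W m \<omega> * I \<omega>) * D \<omega>)"
    "expectation (\<lambda>\<omega>. (W m \<omega> * I \<omega>) * D \<omega>) = 0"
    using indep_var_integrable[OF indep_WI WI_int D(1)]
      indep_var_lebesgue_integral[OF indep_WI WI_int D(1)] D(3) by auto
  have ID2_meas: "(\<lambda>\<omega>. I \<omega> * (D \<omega>)\<^sup>2) \<in> borel_measurable M"
    using I_meas borel_measurable_integrable[OF D(1)] by measurable
  have ID2: "integrable M (\<lambda>\<omega>. I \<omega> * (D \<omega>)\<^sup>2)"
    by (rule Bochner_Integration.integrable_bound[OF D(2)])
      (use ID2_meas in \<open>auto simp: I_def\<close>)
  have "expectation (\<lambda>\<omega>. I \<omega> * (D \<omega>)\<^sup>2) \<le> expectation (\<lambda>\<omega>. (D \<omega>)\<^sup>2)"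
    by (intro integral_mono ID2 D(2)) (auto simp: I_def)
  then have ID2_le: "expectation (\<lambda>\<omega>. I \<omega> * (D \<omega>)\<^sup>2) \<le> 1 / real k"
    using D(4) by simp
  \<comment> \<open>The square of \<open>I\<close> is \<open>I\<close>, and the cross term has mean
    zero by independence, so a step adds at most \<open>1 / real k\<close> to the second
    moment.\<close>
  have sq: "(W (Suc m) \<omega>)\<^sup>2 = (W m \<omega>)\<^sup>2 + 2 * ((W m \<omega> * I \<omega>) * D \<omega>) + I \<omega> * (D \<omega>)\<^sup>2" for \<omega>
    unfolding W_Suc by (auto simp: I_def power2_eq_square algebra_simps)
  have "(\<lambda>\<omega>. W m \<omega> + I \<omega> * D \<omega>) \<in> borel_measurable (past ?t)"
    unfolding D_def
    using measurable_past_mono[OF W(1), of ?t] measurable_past_mono[OF I_past, of ?t]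
      measurable_past[of ?s ?t] measurable_past[of ?t ?t] st
    by (intro borel_measurable_add borel_measurable_times borel_measurable_diff) auto
  moreover have "expectation (\<lambda>\<omega>. (W (Suc m) \<omega>)\<^sup>2) \<le> ?s + 1 / real k"
    unfolding sq using W(3,5) WID ID2 ID2_le by simp
  moreover have "?s + 1 / real k = ?t"
    using st(4) by linarith
  moreover have "integrable M (\<lambda>\<omega>. (W (Suc m) \<omega>)\<^sup>2)"
    unfolding sq using W(3) WID(1) ID2 by (intro Bochner_Integration.integrable_add) auto
  moreover have "integrable M (W (Suc m))"
    unfolding W_Suc using W(2) ID(1) by (rule Bochner_Integration.integrable_add)
  moreover have "expectation (W (Suc m)) = 0"
    unfolding W_Suc using W(2,4) ID by (subst Bochner_Integration.integral_add) auto
  ultimately show ?case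
    by (simp only: W_Suc)
qed

text \<open>Rounding \<open>r\<close> up to the grid of mesh \<open>1 / Suc k\<close> leaves
  countably many values, which gives measurability; path continuity carries it to the limit.
  Rounding up matches the stopping rule of the walk above.\<close>

lemma measurable_at_time:
  fixes r :: "'a \<Rightarrow> real"
  assumes r: "r \<in> borel_measurable M" and nonneg: "\<And>\<omega>. \<omega> \<in> space M \<Longrightarrow> 0 \<le> r \<omega>"
  shows "(\<lambda>\<omega>. B (r \<omega>) \<omega>) \<in> borel_measurable M"
    and "\<And>\<omega>. \<omega> \<in> space M \<Longrightarrow>
      (\<lambda>k. B (real (nat \<lceil>r \<omega> * real (Suc k)\<rceil>) / real (Suc k)) \<omega>) \<longlonglongrightarrow> B (r \<omega>) \<omega>"
proof -
  let ?q = "\<lambda>k \<omega>. real (nat \<lceil>r \<omega> * real (Suc k)\<rceil>) / real (Suc k)"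
  show lim: "(\<lambda>k. B (?q k \<omega>) \<omega>) \<longlonglongrightarrow> B (r \<omega>) \<omega>" if \<omega>: "\<omega> \<in> space M" for \<omega>
  proof (rule continuous_on_tendsto_compose[OF continuous_paths[OF \<omega>]])
    have q: "r \<omega> \<le> ?q k \<omega>" "?q k \<omega> \<le> r \<omega> + 1 / real (Suc k)" for k
    proof -
      have "0 \<le> r \<omega> * real (Suc k)"
        using nonneg[OF \<omega>] by simp
      then have "real (nat \<lceil>r \<omega> * real (Suc k)\<rceil>) = of_int \<lceil>r \<omega> * real (Suc k)\<rceil>"
        by simp
      then have "r \<omega> * real (Suc k) \<le> real (nat \<lceil>r \<omega> * real (Suc k)\<rceil>)"
        "real (nat \<lceil>r \<omega> * real (Suc k)\<rceil>) \<le> r \<omega> * real (Suc k) + 1"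
        by linarith+
      then show "r \<omega> \<le> ?q k \<omega>" "?q k \<omega> \<le> r \<omega> + 1 / real (Suc k)"
        by (simp_all add: pos_le_divide_eq pos_divide_le_eq distrib_right del: of_nat_Suc)
    qed
    have "(\<lambda>k. r \<omega> + 1 / real (Suc k)) \<longlonglongrightarrow> r \<omega> + 0"
      by (intro tendsto_add tendsto_const LIMSEQ_Suc[OF lim_const_over_n])
    then have upper: "(\<lambda>k. r \<omega> + 1 / real (Suc k)) \<longlonglongrightarrow> r \<omega>"
      by (simp only: add_0_right)
    show "(\<lambda>k. ?q k \<omega>) \<longlonglongrightarrow> r \<omega>"
      by (rule tendsto_sandwich[OF always_eventually always_eventually tendsto_const upper])
        (intro allI q)+
    show "r \<omega> \<in> {0..}" "\<forall>\<^sub>F k in sequentially. ?q k \<omega> \<in> {0..}"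
      using nonneg[OF \<omega>] order_trans[OF nonneg[OF \<omega>] q(1)]
      by (auto intro!: always_eventually simp del: of_nat_Suc of_nat_nat)
  qed
  have "(\<lambda>\<omega>. B (?q k \<omega>) \<omega>) \<in> borel_measurable M" for k
  proof (rule measurable_compose_countable[where f="\<lambda>m. B (real m / real (Suc k))"])
    show "(\<lambda>\<omega>. nat \<lceil>r \<omega> * real (Suc k)\<rceil>) \<in> measurable M (count_space UNIV)"
      using r by measurable
  qed (simp add: random_variable_B del: of_nat_Suc)
  then show "(\<lambda>\<omega>. B (r \<omega>) \<omega>) \<in> borel_measurable M"
    by (rule borel_measurable_LIMSEQ_real[rotated]) (rule lim)
qed

text \<open>\<open>B\<close> at \<open>r\<close> rounded up to the grid, minus \<open>B 0\<close>,
  is the stopped walk, with mean 0 and second moment at most \<open>t + 1\<close> for every mesh.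
  The second moment criterion then passes the mean to the limit.\<close>

lemma optional_stopping:
  fixes r :: "'a \<Rightarrow> real"
  assumes B0: "integrable M (B 0)"
    and bounds: "\<And>\<omega>. \<omega> \<in> space M \<Longrightarrow> 0 \<le> r \<omega>" "\<And>\<omega>. \<omega> \<in> space M \<Longrightarrow> r \<omega> \<le> t"
    and r: "\<And>s. 0 \<le> s \<Longrightarrow> {\<omega> \<in> space M. r \<omega> \<le> s} \<in> sets (past s)"
  shows "integrable M (\<lambda>\<omega>. B (r \<omega>) \<omega>)"
    and "expectation (\<lambda>\<omega>. B (r \<omega>) \<omega>) = expectation (B 0)"
proof -
  have r_meas: "r \<in> borel_measurable M"
  proof (rule borel_measurableI_le)
    fix s
    show "{\<omega> \<in> space M. r \<omega> \<le> s} \<in> sets M"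
    proof (cases "0 \<le> s")
      case False
      then have "{\<omega> \<in> space M. r \<omega> \<le> s} = {}"
        using bounds(1) by fastforce
      then show ?thesis
        by (simp only: sets.empty_sets)
    qed (use r past_subset in blast)
  qed
  have at_r: "(\<lambda>\<omega>. B (r \<omega>) \<omega>) \<in> borel_measurable M" "\<And>\<omega>. \<omega> \<in> space M \<Longrightarrow>
      (\<lambda>k. B (real (nat \<lceil>r \<omega> * real (Suc k)\<rceil>) / real (Suc k)) \<omega>) \<longlonglongrightarrow> B (r \<omega>) \<omega>"
    using measurable_at_time[OF r_meas] bounds(1) by blast+
  \<comment> \<open>Enough grid steps to reach \<open>t\<close>; the last grid point overshoots by
    at most one mesh, whence the uniform bound \<open>t + 1\<close>.\<close>
  define N where "N k = nat \<lceil>t * real (Suc k)\<rceil>" for k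
  define W where "W k \<omega> = (\<Sum>j<N k. if real j / real (Suc k) < r \<omega>
    then B (real (Suc j) / real (Suc k)) \<omega> - B (real j / real (Suc k)) \<omega> else 0)" for k \<omega>
  have t: "0 \<le> t"
    using bounds not_empty by (meson ex_in_conv order_trans)
  have N: "real (N k) / real (Suc k) \<le> t + 1" for k
  proof -
    have "0 \<le> t * real (Suc k)"
      using t by simp
    then have "real (N k) \<le> t * real (Suc k) + 1"
      unfolding N_def by linarith
    also have "\<dots> \<le> (t + 1) * real (Suc k)"
      by (simp add: algebra_simps)
    finally show ?thesis
      by (simp add: field_simps)
  qed
  have W_eq: "W k \<omega> = B (real (nat \<lceil>r \<omega> * real (Suc k)\<rceil>) / real (Suc k)) \<omega> - B 0 \<omega>"
    if \<omega>: "\<omega> \<in> space M" for k \<omega>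
  proof -
    let ?m = "nat \<lceil>r \<omega> * real (Suc k)\<rceil>"
    \<comment> \<open>Exactly the first \<open>?m\<close> increments are switched on, and their sum
      telescopes.\<close>
    have m: "real j / real (Suc k) < r \<omega> \<longleftrightarrow> j < ?m" for j
    proof -
      have "real j / real (Suc k) < r \<omega> \<longleftrightarrow> real j < r \<omega> * real (Suc k)"
        by (simp add: field_simps)
      also have "\<dots> \<longleftrightarrow> j < ?m"
        by linarith
      finally show ?thesis .
    qed
    have "r \<omega> * real (Suc k) \<le> t * real (Suc k)"
      using bounds(2)[OF \<omega>] by (intro mult_right_mono) auto
    then have "?m \<le> N k"
      unfolding N_def by (intro nat_mono ceiling_mono)
    then have "{..<N k} \<inter> {j. j < ?m} = {..<?m}"
      by (auto simp only: lessThan_def Int_iff mem_Collect_eq set_eq_iff less_le_trans)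
    then have "W k \<omega> = (\<Sum>j<?m. B (real (Suc j) / real (Suc k)) \<omega> - B (real j / real (Suc k)) \<omega>)"
      unfolding W_def m by (simp add: sum.If_cases)
    also have "\<dots> = B (real ?m / real (Suc k)) \<omega> - B 0 \<omega>"
      by (subst sum_lessThan_telescope[of "\<lambda>j. B (real j / real (Suc k)) \<omega>"]) simp
    finally show ?thesis .
  qed
  have walk: "integrable M (W k)" "integrable M (\<lambda>\<omega>. (W k \<omega>)\<^sup>2)" "expectation (W k) = 0"
    "expectation (\<lambda>\<omega>. (W k \<omega>)\<^sup>2) \<le> t + 1" for k
    using stopped_walk[of "Suc k" r "N k", OF _ r] N[of k] unfolding W_def by auto
  have lim: "(\<lambda>k. W k \<omega>) \<longlonglongrightarrow> B (r \<omega>) \<omega> - B 0 \<omega>" if "\<omega> \<in> space M" for \<omega>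
    unfolding W_eq[OF that] by (intro tendsto_diff at_r(2) that tendsto_const)
  have meas: "(\<lambda>\<omega>. B (r \<omega>) \<omega> - B 0 \<omega>) \<in> borel_measurable M"
    using at_r(1) B0 by simp
  from expectation_zero_of_L2_bounded[OF walk meas lim]
  have *: "integrable M (\<lambda>\<omega>. B (r \<omega>) \<omega> - B 0 \<omega>)" "expectation (\<lambda>\<omega>. B (r \<omega>) \<omega> - B 0 \<omega>) = 0"
    by auto
  from Bochner_Integration.integrable_add[OF *(1) B0] show I: "integrable M (\<lambda>\<omega>. B (r \<omega>) \<omega>)"
    by simp
  show "expectation (\<lambda>\<omega>. B (r \<omega>) \<omega>) = expectation (B 0)"
    using *(2) I B0 by simp
qed

end

section \<open>Entry times\<close>

text \<open>A convex set missing \<open>x\<close> lies on one side of \<open>x\<close>, and so does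
  its closure; \<open>c\<close> is the sign of that side.\<close>

lemma abs_diff_eq_on_closure:
  fixes J :: "real set"
  assumes J: "convex J" and x: "x \<notin> J"
  obtains c :: real where "\<And>y. y \<in> closure J \<Longrightarrow> \<bar>y - x\<bar> = c * (y - x)"
proof -
  have "J \<subseteq> {x..} \<or> J \<subseteq> {..x}"
  proof (rule ccontr)
    assume "\<not> (J \<subseteq> {x..} \<or> J \<subseteq> {..x})"
    then obtain y z where "y \<in> J" "z \<in> J" "y < x" "x < z"
      by fastforce
    then show False
      using J x by (meson convex_contains_segment closed_segment_eq_real_ivl subsetD
          atLeastAtMost_iff less_imp_le is_interval_convex_1 mem_is_interval_1_I)
  qed
  then show ?thesis
  proof
    assume "J \<subseteq> {x..}"
    then have "closure J \<subseteq> {x..}"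
      by (rule closure_minimal) auto
    then show ?thesis
      by (intro that[of 1]) auto
  next
    assume "J \<subseteq> {..x}"
    then have "closure J \<subseteq> {..x}"
      by (rule closure_minimal) auto
    then show ?thesis
      by (intro that[of "-1"]) auto
  qed
qed

section \<open>First entry into a closed set after a given time\<close>

context brownian_motion
begin

text \<open>One step of the recursion for the exit times, with a real set in place of the extended
  interval. The empty infimum \<infinity> encodes that \<open>F\<close> is never entered.\<close>

definition entry_time :: "('a \<Rightarrow> ereal) \<Rightarrow> real set \<Rightarrow> 'a \<Rightarrow> ereal" where
  "entry_time \<tau> F \<omega> = Inf (ereal ` {t. 0 \<le> t \<and> \<tau> \<omega> \<le> ereal t \<and> B t \<omega> \<in> F})"

text \<open>Stopping times of the raw natural filtration, neither completed nor made
  right-continuous. Entry into a closed set is still such a time because every path is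
  continuous.\<close>

definition stopping :: "('a \<Rightarrow> ereal) \<Rightarrow> bool" where
  "stopping \<tau> \<longleftrightarrow> (\<forall>\<omega>\<in>space M. 0 \<le> \<tau> \<omega>) \<and>
     (\<forall>s\<ge>0. {\<omega> \<in> space M. \<tau> \<omega> \<le> ereal s} \<in> sets (past s))"

text \<open>By continuity of the path the admissible times form a closed set, so a finite infimum is
  attained.\<close>

lemma entry_time_cases:
  assumes \<omega>: "\<omega> \<in> space M" and F: "closed F"
  obtains (never) "entry_time \<tau> F \<omega> = \<infinity>" "\<And>t. 0 \<le> t \<Longrightarrow> \<tau> \<omega> \<le> ereal t \<Longrightarrow> B t \<omega> \<notin> F"
  | (at) s where "entry_time \<tau> F \<omega> = ereal s" "0 \<le> s" "\<tau> \<omega> \<le> ereal s" "B s \<omega> \<in> F"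
      "\<And>t. 0 \<le> t \<Longrightarrow> \<tau> \<omega> \<le> ereal t \<Longrightarrow> t < s \<Longrightarrow> B t \<omega> \<notin> F"
proof -
  let ?A = "{t. 0 \<le> t \<and> \<tau> \<omega> \<le> ereal t \<and> B t \<omega> \<in> F}"
  show ?thesis
  proof (cases "?A = {}")
    case True
    show ?thesis
    proof (rule never)
      show "entry_time \<tau> F \<omega> = \<infinity>"
        unfolding entry_time_def True by (simp add: top_ereal_def)
    qed (use True in auto)
  next
    case False
    let ?S = "{0..} \<inter> {t. \<tau> \<omega> \<le> ereal t}"
    have "closed ?S"
      by (intro closed_Int closed_atLeast closed_Collect_le continuous_intros)
    moreover have "continuous_on ?S (\<lambda>t. B t \<omega>)"
      by (rule continuous_on_subset[OF continuous_paths[OF \<omega>]]) auto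
    ultimately have "closed (?S \<inter> (\<lambda>t. B t \<omega>) -` F)"
      using F by (intro continuous_closed_preimage)
    moreover have "?S \<inter> (\<lambda>t. B t \<omega>) -` F = ?A"
      by auto
    ultimately have closed: "closed ?A"
      by simp
    have bdd: "bdd_below ?A"
      by (rule bdd_belowI[of _ 0]) auto
    have mem: "Inf ?A \<in> ?A"
      by (rule closed_contains_Inf[OF False bdd closed])
    have "entry_time \<tau> F \<omega> = ereal (Inf ?A)"
      unfolding entry_time_def
      by (rule antisym) (use mem cInf_lower[OF _ bdd] in \<open>auto intro!: INF_greatest INF_lower\<close>)
    then show ?thesis
      using mem cInf_lower[OF _ bdd] by (intro at[of "Inf ?A"]) fastforce+
  qed
qed

lemma entry_time_ge:
  assumes "\<omega> \<in> space M" "closed F"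
  shows "\<tau> \<omega> \<le> entry_time \<tau> F \<omega>"
  by (cases rule: entry_time_cases[OF assms, of \<tau>]) auto

text \<open>This replaces uncountably many candidate times by countably many. If entry occurs at
  \<open>r < s\<close>, rational times just to the right of \<open>r\<close> see the path near
  \<open>F\<close> and still lie after \<open>\<tau>\<close>; entry at \<open>s\<close> itself is
  covered by inserting \<open>s\<close>. Conversely, compactness of the interval from 0 to
  \<open>s\<close> turns times of approximate entry into a limit time at which the path is in
  \<open>F\<close>.\<close>

lemma entry_time_le_iff_approx:
  assumes \<omega>: "\<omega> \<in> space M" and F: "closed F"
  shows "entry_time \<tau> F \<omega> \<le> ereal s \<longleftrightarrow>
    (\<forall>k::nat. \<exists>q\<in>{0..s} \<inter> insert s \<rat>. \<tau> \<omega> \<le> ereal q \<and> (\<exists>z\<in>F. dist z (B q \<omega>) < 1 / real (Suc k)))"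
    (is "?L \<longleftrightarrow> (\<forall>k. ?R k)")
proof
  assume L: ?L
  show "\<forall>k. ?R k"
  proof
    fix k
    from L obtain r where r: "0 \<le> r" "r \<le> s" "\<tau> \<omega> \<le> ereal r" "B r \<omega> \<in> F"
      by (cases rule: entry_time_cases[OF \<omega> F, of \<tau>]) auto
    show "?R k"
    proof (cases "r = s")
      case True
      then show ?thesis
        using r by (intro bexI[of _ s] conjI bexI[of _ "B s \<omega>"]) auto
    next
      case False
      obtain \<delta> where \<delta>: "0 < \<delta>"
        "\<And>q. 0 \<le> q \<Longrightarrow> dist q r < \<delta> \<Longrightarrow> dist (B q \<omega>) (B r \<omega>) < 1 / real (Suc k)"
        using continuous_paths[OF \<omega>, unfolded continuous_on_iff, rule_format, of r "1 / real (Suc k)"] r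
        by auto
      obtain q where q: "q \<in> \<rat>" "r < q" "q < min s (r + \<delta>)"
        using Rats_dense_in_real[of r "min s (r + \<delta>)"] False r \<delta> by auto
      then have "dist (B q \<omega>) (B r \<omega>) < 1 / real (Suc k)"
        using r by (intro \<delta>) (auto simp: dist_real_def)
      moreover have "\<tau> \<omega> \<le> ereal q"
        using r(3) q(2) by (meson ereal_less_eq(3) less_imp_le order_trans)
      ultimately show ?thesis
        using q r by (intro bexI[of _ q] conjI bexI[of _ "B r \<omega>"]) (auto simp: dist_commute)
    qed
  qed
next
  assume "\<forall>k. ?R k"
  then obtain q z where q: "\<And>k. q k \<in> {0..s}" "\<And>k. \<tau> \<omega> \<le> ereal (q k)"
    and z: "\<And>k. z k \<in> F" "\<And>k. dist (z k) (B (q k) \<omega>) < 1 / real (Suc k)"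
    by (metis Int_iff)
  obtain l \<phi> where l: "l \<in> {0..s}" "strict_mono \<phi>" "(q \<circ> \<phi>) \<longlonglongrightarrow> l"
    using compact_Icc[of 0 s, unfolded compact_def] q(1) by metis
  have B_lim: "(\<lambda>k. B ((q \<circ> \<phi>) k) \<omega>) \<longlonglongrightarrow> B l \<omega>"
    by (rule continuous_on_tendsto_compose[OF continuous_paths[OF \<omega>] l(3)])
      (use l(1) q(1) in auto)
  have "(\<lambda>k. dist (z (\<phi> k)) (B ((q \<circ> \<phi>) k) \<omega>)) \<longlonglongrightarrow> 0"
  proof (rule tendsto_sandwich[OF always_eventually always_eventually tendsto_const])
    show "(\<lambda>k. 1 / real (Suc (\<phi> k))) \<longlonglongrightarrow> 0"
      using LIMSEQ_subseq_LIMSEQ[OF LIMSEQ_Suc[OF lim_const_over_n[of 1]] l(2)] by (simp add: o_def)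
  qed (use z(2) in \<open>auto intro: less_imp_le\<close>)
  then have "(\<lambda>k. z (\<phi> k) - B ((q \<circ> \<phi>) k) \<omega>) \<longlonglongrightarrow> 0"
    by (simp add: dist_norm tendsto_norm_zero_iff tendsto_rabs_zero_iff)
  from tendsto_add[OF this B_lim] have "(\<lambda>k. z (\<phi> k)) \<longlonglongrightarrow> B l \<omega>"
    by simp
  then have "B l \<omega> \<in> F"
    by (rule closed_sequentially[OF F z(1)])
  moreover have "\<tau> \<omega> \<le> ereal l"
    by (rule LIMSEQ_le_const[OF tendsto_ereal[OF l(3)]]) (use q(2) in auto)
  ultimately have "entry_time \<tau> F \<omega> \<le> ereal l"
    unfolding entry_time_def using l(1) by (intro Inf_lower imageI) auto
  also have "\<dots> \<le> ereal s"
    using l(1) by simp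
  finally show ?L .
qed

text \<open>The criterion above writes the event through countable unions and intersections of
  events at times \<open>q \<le> s\<close>, all of which belong to \<open>past s\<close>.\<close>

lemma stopping_entry_time:
  assumes \<tau>: "stopping \<tau>" and F: "closed F"
  shows "stopping (entry_time \<tau> F)"
  unfolding stopping_def
proof (intro conjI ballI allI impI)
  fix \<omega> assume "\<omega> \<in> space M"
  then show "0 \<le> entry_time \<tau> F \<omega>"
    using \<tau> entry_time_ge[OF _ F, of \<omega> \<tau>] unfolding stopping_def by (meson order_trans)
next
  fix s :: real assume s: "0 \<le> s"
  let ?U = "\<lambda>k. \<Union>z\<in>F. ball z (1 / real (Suc k))"
  let ?D = "{0..s} \<inter> insert s \<rat>"
  have piece: "{\<omega> \<in> space M. \<tau> \<omega> \<le> ereal q} \<inter> (B q -` ?U k \<inter> space (past s)) \<in> sets (past s)"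
    if q: "q \<in> ?D" for k q
  proof (rule sets.Int)
    have "{\<omega> \<in> space M. \<tau> \<omega> \<le> ereal q} \<in> sets (past q)"
      using \<tau> q unfolding stopping_def by auto
    then show "{\<omega> \<in> space M. \<tau> \<omega> \<le> ereal q} \<in> sets (past s)"
      using past_mono[of q s] q by auto
    have "?U k \<in> sets borel"
      by (intro borel_open open_UN ballI open_ball)
    then show "B q -` ?U k \<inter> space (past s) \<in> sets (past s)"
      using q by (intro measurable_sets[OF measurable_past]) auto
  qed
  have "{\<omega> \<in> space M. entry_time \<tau> F \<omega> \<le> ereal s} =
    (\<Inter>k. \<Union>q\<in>?D. {\<omega> \<in> space M. \<tau> \<omega> \<le> ereal q} \<inter> (B q -` ?U k \<inter> space (past s)))"
    using entry_time_le_iff_approx[OF _ F, of _ \<tau> s] by auto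
  also have "\<dots> \<in> sets (past s)"
    using piece by (intro sets.countable_INT image_subsetI sets.countable_UN''
      countable_Int2 countable_insert countable_rat) auto
  finally show "{\<omega> \<in> space M. entry_time \<tau> F \<omega> \<le> ereal s} \<in> sets (past s)" .
qed

lemma stopping_measurable:
  assumes "stopping \<tau>"
  shows "\<tau> \<in> borel_measurable M"
proof (rule borel_measurable_iff_Iic_ereal[THEN iffD2], rule allI)
  fix a
  have nonneg: "\<And>\<omega>. \<omega> \<in> space M \<Longrightarrow> 0 \<le> \<tau> \<omega>"
    using assms by (auto simp: stopping_def)
  have "\<tau> -` {..\<infinity>} \<inter> space M = space M"
    by auto
  then have top: "\<tau> -` {..\<infinity>} \<inter> space M \<in> sets M"
    by simp
  consider "a = \<infinity>" | s where "a = ereal s" "0 \<le> s" | "a < 0"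
    by (cases a) (auto, meson not_le)
  then show "\<tau> -` {..a} \<inter> space M \<in> sets M"
  proof cases
    case 2
    then have "{\<omega> \<in> space M. \<tau> \<omega> \<le> ereal s} \<in> sets M"
      using assms past_subset[of s] unfolding stopping_def by blast
    also have "{\<omega> \<in> space M. \<tau> \<omega> \<le> ereal s} = \<tau> -` {..a} \<inter> space M"
      using 2 by auto
    finally show ?thesis .
  next
    case 3
    then have "\<tau> -` {..a} \<inter> space M = {}"
      using nonneg by fastforce
    then show ?thesis
      by simp
  qed (use top in simp)
qed

text \<open>For nonnegative \<open>\<tau>\<close> and \<open>t\<close> the minimum is finite, so
  \<open>real_of_ereal\<close> does not produce its dummy value here.\<close>

definition stopped :: "('a \<Rightarrow> ereal) \<Rightarrow> real \<Rightarrow> 'a \<Rightarrow> real" where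
  "stopped \<tau> t \<omega> = B (real_of_ereal (min (\<tau> \<omega>) (ereal t))) \<omega>"

lemma
  assumes \<tau>: "stopping \<tau>" and t: "0 \<le> t" and B0: "integrable M (B 0)"
  shows integrable_stopped: "integrable M (stopped \<tau> t)"
    and expectation_stopped: "expectation (stopped \<tau> t) = expectation (B 0)"
proof -
  let ?r = "\<lambda>\<omega>. real_of_ereal (min (\<tau> \<omega>) (ereal t))"
  have bounds: "0 \<le> ?r \<omega>" "?r \<omega> \<le> t" if "\<omega> \<in> space M" for \<omega>
    using \<tau> that t unfolding stopping_def by (cases "\<tau> \<omega>"; auto simp: min_def)+
  have r_past: "{\<omega> \<in> space M. ?r \<omega> \<le> s} \<in> sets (past s)" if s: "0 \<le> s" for s
  proof (cases "t \<le> s")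
    case True
    have "?r \<omega> \<le> s" if "\<omega> \<in> space M" for \<omega>
      using \<tau> that True unfolding stopping_def by (cases "\<tau> \<omega>") (auto simp: min_def)
    then have "{\<omega> \<in> space M. ?r \<omega> \<le> s} = space (past s)"
      by auto
    then show ?thesis
      by (simp only: sets.top)
  next
    case False
    have "?r \<omega> \<le> s \<longleftrightarrow> \<tau> \<omega> \<le> ereal s" if "\<omega> \<in> space M" for \<omega>
      using \<tau> that False unfolding stopping_def by (cases "\<tau> \<omega>") (auto simp: min_def)
    then have "{\<omega> \<in> space M. ?r \<omega> \<le> s} = {\<omega> \<in> space M. \<tau> \<omega> \<le> ereal s}"
      by auto
    then show ?thesis
      using \<tau> s unfolding stopping_def by simp
  qed
  have eq: "stopped \<tau> t = (\<lambda>\<omega>. B (?r \<omega>) \<omega>)"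
    by (simp add: stopped_def[abs_def])
  show "integrable M (stopped \<tau> t)"
    unfolding eq by (rule optional_stopping(1)[where r="?r" and t=t]) (fact B0, erule bounds(1), erule bounds(2), erule r_past)
  show "expectation (stopped \<tau> t) = expectation (B 0)"
    unfolding eq by (rule optional_stopping(2)[where r="?r" and t=t]) (fact B0, erule bounds(1), erule bounds(2), erule r_past)
qed

text \<open>From \<open>\<tau>\<close> until just before the entry into \<open>- J\<close> the path
  runs in \<open>J\<close>, so by continuity the two stopped values lie in the closure of
  \<open>J\<close> unless no time passes between them.\<close>

lemma stopped_entry_time:
  assumes \<omega>: "\<omega> \<in> space M" and J: "open J" and \<tau>: "0 \<le> \<tau> \<omega>" and t: "0 \<le> t"
  defines "\<sigma> \<equiv> entry_time \<tau> (- J)"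
  shows "stopped \<sigma> t \<omega> = stopped \<tau> t \<omega> \<or>
    stopped \<sigma> t \<omega> \<in> closure J \<and> stopped \<tau> t \<omega> \<in> closure J"
proof -
  have F: "closed (- J)"
    using J by (rule closed_Compl)
  have le: "\<tau> \<omega> \<le> \<sigma> \<omega>"
    unfolding \<sigma>_def by (rule entry_time_ge[OF \<omega> F])
  show ?thesis
  proof (cases "\<tau> \<omega> < ereal t")
    case False
    then show ?thesis
      using le by (simp add: stopped_def min_absorb2)
  next
    case True
    then obtain s where s: "\<tau> \<omega> = ereal s" "0 \<le> s" "s < t"
      using \<tau> by (cases "\<tau> \<omega>") auto
    have stopped_\<tau>: "stopped \<tau> t \<omega> = B s \<omega>"
      using s by (simp add: stopped_def min_absorb1)
    have no_entry: "B v \<omega> \<in> J" if "s \<le> v" "ereal v < \<sigma> \<omega>" for v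
      using that s unfolding \<sigma>_def by (cases rule: entry_time_cases[OF \<omega> F, of \<tau>]) auto
    obtain m where m: "ereal m = min (\<sigma> \<omega>) (ereal t)"
      using le s by (cases "min (\<sigma> \<omega>) (ereal t)") (auto simp: min_def split: if_splits)
    have stopped_\<sigma>: "stopped \<sigma> t \<omega> = B m \<omega>"
      unfolding stopped_def m[symmetric] by simp
    have "ereal s \<le> min (\<sigma> \<omega>) (ereal t)"
      using le s by simp
    then have "s \<le> m"
      unfolding m[symmetric] by simp
    show ?thesis
    proof (cases "s = m")
      case True
      then show ?thesis
        by (simp add: stopped_\<tau> stopped_\<sigma>)
    next
      case False
      with \<open>s \<le> m\<close> have "s < m"
        by simp
      have "B v \<omega> \<in> J" if "v \<in> {s..<m}" for v
      proof (rule no_entry)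
        have "ereal v < ereal m"
          using that by simp
        then show "ereal v < \<sigma> \<omega>"
          unfolding m by simp
      qed (use that in auto)
      moreover have "continuous_on (closure {s..<m}) (\<lambda>v. B v \<omega>)"
        using s by (intro continuous_on_subset[OF continuous_paths[OF \<omega>]]) (auto simp: \<open>s < m\<close>)
      ultimately have "(\<lambda>v. B v \<omega>) ` closure {s..<m} \<subseteq> closure J"
        using closure_subset[of J] by (intro image_closure_subset) auto
      then show ?thesis
        using \<open>s < m\<close> by (auto simp: stopped_\<tau> stopped_\<sigma>)
    qed
  qed
qed

text \<open>On the closure of \<open>J\<close> the distance to \<open>x\<close> is affine, so the
  two absolute values differ by a multiple of the difference of the stopped values, both of which
  have the mean of \<open>B 0\<close>.\<close>

lemma expectation_abs_stopped_entry_time: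
  assumes \<tau>: "stopping \<tau>" and t: "0 \<le> t" and B0: "integrable M (B 0)"
    and J: "open J" "convex J" and x: "x \<notin> J"
  shows "expectation (\<lambda>\<omega>. \<bar>stopped (entry_time \<tau> (- J)) t \<omega> - x\<bar>) =
    expectation (\<lambda>\<omega>. \<bar>stopped \<tau> t \<omega> - x\<bar>)"
proof -
  let ?\<sigma> = "entry_time \<tau> (- J)"
  obtain c where c: "\<And>y. y \<in> closure J \<Longrightarrow> \<bar>y - x\<bar> = c * (y - x)"
    using abs_diff_eq_on_closure[OF J(2) x] by blast
  have \<sigma>: "stopping ?\<sigma>"
    by (rule stopping_entry_time[OF \<tau> closed_Compl[OF J(1)]])
  note [simp] = integrable_stopped[OF \<tau> t B0] integrable_stopped[OF \<sigma> t B0]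
  have "\<bar>stopped ?\<sigma> t \<omega> - x\<bar> = \<bar>stopped \<tau> t \<omega> - x\<bar> + c * (stopped ?\<sigma> t \<omega> - stopped \<tau> t \<omega>)"
    if "\<omega> \<in> space M" for \<omega>
  proof -
    have "0 \<le> \<tau> \<omega>"
      using \<tau> that by (simp add: stopping_def)
    from stopped_entry_time[where \<tau>=\<tau>, OF that J(1) this t] show ?thesis
    proof
      assume "stopped ?\<sigma> t \<omega> = stopped \<tau> t \<omega>"
      then show ?thesis
        by simp
    next
      assume "stopped ?\<sigma> t \<omega> \<in> closure J \<and> stopped \<tau> t \<omega> \<in> closure J"
      then have "\<bar>stopped ?\<sigma> t \<omega> - x\<bar> = c * (stopped ?\<sigma> t \<omega> - x)"
        "\<bar>stopped \<tau> t \<omega> - x\<bar> = c * (stopped \<tau> t \<omega> - x)"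
        using c by auto
      then show ?thesis
        by (simp only: right_diff_distrib)
    qed
  qed
  then have "expectation (\<lambda>\<omega>. \<bar>stopped ?\<sigma> t \<omega> - x\<bar>) =
    expectation (\<lambda>\<omega>. \<bar>stopped \<tau> t \<omega> - x\<bar> + c * (stopped ?\<sigma> t \<omega> - stopped \<tau> t \<omega>))"
    by (intro Bochner_Integration.integral_cong) auto
  also have "\<dots> = expectation (\<lambda>\<omega>. \<bar>stopped \<tau> t \<omega> - x\<bar>)"
    using expectation_stopped[OF \<tau> t B0] expectation_stopped[OF \<sigma> t B0] by simp
  finally show ?thesis .
qed

end

section \<open>Contact sets of affine and concave functions\<close>

text \<open>This ties the contact sets to the endpoints in the definition of the exit times.
  Openness makes the inequalities strict, and convexity fills in everything between.\<close>

lemma open_convex_eq_ereal_interval: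
  fixes S :: "real set"
  assumes "open S" "convex S"
  shows "S = {x. Inf (ereal ` S) < ereal x \<and> ereal x < Sup (ereal ` S)}"
proof (intro equalityI subsetI CollectI conjI)
  fix x assume x: "x \<in> S"
  then obtain e where e: "0 < e" "ball x e \<subseteq> S"
    using \<open>open S\<close> openE by blast
  then have "x - e / 2 \<in> S" "x + e / 2 \<in> S"
    by (auto simp: subset_iff dist_real_def)
  then have le: "Inf (ereal ` S) \<le> ereal (x - e / 2)" "ereal (x + e / 2) \<le> Sup (ereal ` S)"
    by (auto intro!: Inf_lower Sup_upper)
  show "Inf (ereal ` S) < ereal x"
    by (rule le_less_trans[OF le(1)]) (use e in simp)
  show "ereal x < Sup (ereal ` S)"
    by (rule less_le_trans[OF _ le(2)]) (use e in simp)
next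
  fix x assume "x \<in> {x. Inf (ereal ` S) < ereal x \<and> ereal x < Sup (ereal ` S)}"
  then obtain y z where "y \<in> S" "y < x" "z \<in> S" "x < z"
    by (auto simp: Inf_less_iff less_Sup_iff)
  then show "x \<in> S"
    using \<open>convex S\<close> by (meson is_interval_convex_1 less_imp_le mem_is_interval_1_I)
qed

lemma open_convex_real_cases:
  fixes S :: "real set"
  assumes "open S" "convex S"
  obtains (empty) "S = {}" | (bounded) a b where "a < b" "S = {a<..<b}"
    | (left) b where "S = {..<b}" | (right) a where "S = {a<..}" | (all) "S = UNIV"
proof -
  note S = open_convex_eq_ereal_interval[OF assms]
  show ?thesis
  proof (cases "S = {}")
    case False
    then obtain x where x: "Inf (ereal ` S) < ereal x" "ereal x < Sup (ereal ` S)"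
      using S by blast
    consider a b where "Inf (ereal ` S) = ereal a" "Sup (ereal ` S) = ereal b"
      | b where "Inf (ereal ` S) = -\<infinity>" "Sup (ereal ` S) = ereal b"
      | a where "Inf (ereal ` S) = ereal a" "Sup (ereal ` S) = \<infinity>"
      | "Inf (ereal ` S) = -\<infinity>" "Sup (ereal ` S) = \<infinity>"
      using x by (cases "Inf (ereal ` S)"; cases "Sup (ereal ` S)") auto
    then show ?thesis
    proof cases
      case 1
      then have "S = {a<..<b}" "a < b"
        using S x by auto
      then show ?thesis
        using bounded by blast
    next
      case 2
      then have "S = {..<b}"
        using S by auto
      then show ?thesis
        using left by blast
    next
      case 3
      then have "S = {a<..}"
        using S by auto
      then show ?thesis
        using right by blast
    next
      case 4
      then have "S = UNIV"
        using S by auto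
      then show ?thesis
        using all by blast
    qed
  qed (use empty in blast)
qed

section \<open>Concavity and the shape of the contact set\<close>

lemma concave_on_min:
  fixes g h :: "real \<Rightarrow> real"
  assumes "concave_on UNIV g" "concave_on UNIV h"
  shows "concave_on UNIV (\<lambda>x. min (g x) (h x))"
  unfolding concave_on_iff
proof (intro conjI ballI allI impI)
  fix x y s t :: real
  assume st: "0 \<le> s" "0 \<le> t" "s + t = 1"
  have "s * min (g x) (h x) + t * min (g y) (h y) \<le> s * g x + t * g y"
    "s * min (g x) (h x) + t * min (g y) (h y) \<le> s * h x + t * h y"
    using st by (auto intro!: add_mono mult_left_mono)
  moreover have "s * g x + t * g y \<le> g (s *\<^sub>R x + t *\<^sub>R y)"
    "s * h x + t * h y \<le> h (s *\<^sub>R x + t *\<^sub>R y)"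
    using assms st unfolding concave_on_iff by auto
  ultimately show "s * min (g x) (h x) + t * min (g y) (h y)
      \<le> min (g (s *\<^sub>R x + t *\<^sub>R y)) (h (s *\<^sub>R x + t *\<^sub>R y))"
    by linarith
qed auto

lemma continuous_on_concave:
  fixes g :: "real \<Rightarrow> real"
  assumes "concave_on UNIV g"
  shows "continuous_on UNIV g"
proof -
  have "continuous_on UNIV (\<lambda>x. - g x)"
    using assms unfolding concave_on_def by (intro convex_on_continuous) auto
  from continuous_on_minus[OF this] show ?thesis
    by simp
qed

text \<open>The contact set is the strict superlevel set at 0 of the concave, hence continuous,
  function \<open>g - f\<close>.\<close>

lemma
  fixes g f :: "real \<Rightarrow> real"
  assumes g: "concave_on UNIV g" and f: "\<And>x. f x = c * x + d"
  shows open_contact_set: "open {x. f x < g x}"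
    and convex_contact_set: "convex {x. f x < g x}"
proof -
  show "open {x. f x < g x}"
    unfolding f by (intro open_Collect_less continuous_on_concave[OF g] continuous_intros)
  show "convex {x. f x < g x}"
    unfolding convex_def
  proof (intro ballI allI impI CollectI)
    fix x y s t :: real
    assume xy: "x \<in> {x. f x < g x}" "y \<in> {x. f x < g x}" and st: "0 \<le> s" "0 \<le> t" "s + t = 1"
    have "f (s *\<^sub>R x + t *\<^sub>R y) = s * f x + t * f y"
      using st(3) by (simp add: f algebra_simps) (metis distrib_left mult.right_neutral)
    also have "\<dots> < s * g x + t * g y"
    proof (cases "s = 0")
      case False
      then have "s * f x < s * g x"
        using xy st by simp
      moreover have "t * f y \<le> t * g y"
        using xy st by (intro mult_left_mono) auto
      ultimately show ?thesis
        by linarith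
    qed (use xy st in auto)
    also have "\<dots> \<le> g (s *\<^sub>R x + t *\<^sub>R y)"
      using g st unfolding concave_on_iff by auto
    finally show "f (s *\<^sub>R x + t *\<^sub>R y) < g (s *\<^sub>R x + t *\<^sub>R y)" .
  qed
qed

text \<open>Since \<open>g\<close> lies below \<open>K - \<bar>x\<bar>\<close> and \<open>f\<close> has slope at most \<open>1\<close> in absolute value, an
  unbounded contact set forces the slope of \<open>f\<close> to be \<open>1\<close> or \<open>- 1\<close>.\<close>

lemma contact_set_cases:
  fixes g f :: "real \<Rightarrow> real"
  assumes g: "concave_on UNIV g" and gK: "\<And>x. g x \<le> K - \<bar>x\<bar>"
    and f: "\<And>x. f x = c * x + d" and c: "\<bar>c\<bar> \<le> 1"
  obtains (empty) "{x. f x < g x} = {}"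
    | (bounded) a b where "a < b" "{x. f x < g x} = {a<..<b}" "f a = g a" "f b = g b"
    | (left) b where "{x. f x < g x} = {..<b}" "f b = g b" "\<And>x. f x = f b + (x - b)"
    | (right) a where "{x. f x < g x} = {a<..}" "f a = g a" "\<And>x. f x = f a + (a - x)"
proof -
  \<comment> \<open>Continuity extends \<open>f \<le> g\<close> to the closure, so the two functions
    meet at every finite endpoint.\<close>
  have touch: "f a = g a" if "a \<in> closure {x. f x < g x}" "a \<notin> {x. f x < g x}" for a
  proof (rule antisym)
    have "closed {x. f x \<le> g x}"
      unfolding f by (intro closed_Collect_le continuous_on_concave[OF g] continuous_intros)
    then have "closure {x. f x < g x} \<subseteq> {x. f x \<le> g x}"
      by (intro closure_minimal) auto
    then show "f a \<le> g a"
      using that by auto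
  qed (use that in auto)
  have left_slope: "c = 1" if "\<And>x. x < b \<Longrightarrow> f x < g x" for b
  proof (rule ccontr)
    assume "c \<noteq> 1"
    then have c1: "c < 1"
      using c by auto
    \<comment> \<open>A point so far to the left that \<open>f x < g x \<le> K + x\<close>, that is
      \<open>d - K < x * (1 - c)\<close>, fails.\<close>
    define x where "x = min (b - 1) (min (-1) (- (\<bar>K\<bar> + \<bar>d\<bar>) / (1 - c)))"
    have "x < b" "x < 0" "x \<le> - (\<bar>K\<bar> + \<bar>d\<bar>) / (1 - c)"
      by (auto simp: x_def)
    moreover from this c1 have "x * (1 - c) \<le> - (\<bar>K\<bar> + \<bar>d\<bar>)"
      by (simp add: pos_le_divide_eq)
    ultimately show False
      using that[of x] gK[of x] unfolding f by (auto simp: algebra_simps)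
  qed
  have right_slope: "c = -1" if "\<And>x. a < x \<Longrightarrow> f x < g x" for a
  proof (rule ccontr)
    assume "c \<noteq> -1"
    then have c1: "0 < 1 + c"
      using c by auto
    define x where "x = max (a + 1) (max 1 ((\<bar>K\<bar> + \<bar>d\<bar>) / (1 + c)))"
    have "a < x" "0 < x" "(\<bar>K\<bar> + \<bar>d\<bar>) / (1 + c) \<le> x"
      by (auto simp: x_def)
    moreover from this c1 have "\<bar>K\<bar> + \<bar>d\<bar> \<le> x * (1 + c)"
      by (simp add: pos_divide_le_eq)
    ultimately show False
      using that[of x] gK[of x] unfolding f by (auto simp: algebra_simps)
  qed
  show ?thesis
  proof (cases rule: open_convex_real_cases[OF open_contact_set[OF g f] convex_contact_set[OF g f]])
    case 1
    then show ?thesis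
      by (rule empty)
  next
    case (2 a b)
    then show ?thesis
      using touch[of a] touch[of b] by (intro bounded[of a b]) auto
  next
    case (3 b)
    then have "c = 1"
      using left_slope[of b] by auto
    then show ?thesis
      using 3 touch[of b] by (intro left[of b]) (auto simp: f)
  next
    case (4 a)
    then have "c = -1"
      using right_slope[of a] by auto
    then show ?thesis
      using 4 touch[of a] by (intro right[of a]) (auto simp: f)
  next
    case 5
    then have "c = 1" "c = -1"
      using left_slope[of 0] right_slope[of 0] by auto
    then show ?thesis
      by simp
  qed
qed

text \<open>Applied with \<open>\<phi> x\<close> the mean distance of a stopped path from
  \<open>x\<close>. Over a bounded contact interval convexity keeps \<open>\<phi>\<close> below the
  chord, which is \<open>- f\<close>. Over a half-line \<open>- f\<close> rises from the endpoint at
  rate 1, as fast as the Lipschitz bound lets \<open>\<phi>\<close> rise.\<close>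

lemma le_uminus_min_of_contact_set:
  fixes g f \<phi> :: "real \<Rightarrow> real"
  assumes g: "concave_on UNIV g" and gK: "\<And>x. g x \<le> K - \<bar>x\<bar>"
    and f: "\<And>x. f x = c * x + d" and c: "\<bar>c\<bar> \<le> 1"
    and convex: "convex_on UNIV \<phi>" and lipschitz: "\<And>x y. \<phi> x \<le> \<phi> y + \<bar>x - y\<bar>"
    and off: "\<And>x. \<not> f x < g x \<Longrightarrow> \<phi> x \<le> - g x"
  shows "\<phi> x \<le> - min (g x) (f x)"
proof (cases "f x < g x")
  case False
  then show ?thesis
    using off[of x] by simp
next
  case True
  then have "\<phi> x \<le> - f x"
  proof (cases rule: contact_set_cases[OF g gK f c])
    case 1
    then show ?thesis
      using True by auto
  next
    case (2 a b)
    from True 2 have x: "a < x" "x < b"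
      by auto
    define s where "s = (b - x) / (b - a)"
    have s: "0 \<le> s" "s \<le> 1"
      using x by (auto simp: s_def)
    have "s * (b - a) = b - x"
      using x by (simp add: s_def)
    then have x_eq: "x = s * a + (1 - s) * b"
      by (simp add: algebra_simps)
    have "\<phi> x \<le> s * \<phi> a + (1 - s) * \<phi> b"
      using convex s unfolding convex_on_def x_eq by (metis UNIV_I add_diff_cancel_left'
          diff_add_cancel diff_ge_0_iff_ge real_scaleR_def)
    also have "\<dots> \<le> s * (- f a) + (1 - s) * (- f b)"
      using s off[of a] off[of b] 2 by (intro add_mono mult_left_mono) auto
    also have "\<dots> = - f x"
      by (simp add: f x_eq algebra_simps)
    finally show ?thesis .
  next
    case (3 b)
    from True 3(1) have "x < b"
      by auto
    moreover from 3(2) have "\<not> f b < g b"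
      by simp
    ultimately show ?thesis
      using lipschitz[of x b] off[of b] 3(2) 3(3)[of x] by linarith
  next
    case (4 a)
    from True 4(1) have "a < x"
      by auto
    moreover from 4(2) have "\<not> f a < g a"
      by simp
    ultimately show ?thesis
      using lipschitz[of x a] off[of a] 4(2) 4(3)[of x] by linarith
  qed
  then show ?thesis
    using True by simp
qed

lemma
  fixes Z :: "'a \<Rightarrow> real"
  assumes M: "prob_space M" and Z: "integrable M Z"
  shows convex_on_expectation_abs: "convex_on UNIV (\<lambda>x. \<integral>\<omega>. \<bar>Z \<omega> - x\<bar> \<partial>M)"
    and expectation_abs_lipschitz: "(\<integral>\<omega>. \<bar>Z \<omega> - x\<bar> \<partial>M) \<le> (\<integral>\<omega>. \<bar>Z \<omega> - y\<bar> \<partial>M) + \<bar>x - y\<bar>"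
proof -
  interpret prob_space M
    by (rule M)
  show "convex_on UNIV (\<lambda>x. expectation (\<lambda>\<omega>. \<bar>Z \<omega> - x\<bar>))"
  proof (rule convex_onI)
    fix t x y :: real
    assume t: "0 < t" "t < 1"
    have "expectation (\<lambda>\<omega>. \<bar>Z \<omega> - ((1 - t) *\<^sub>R x + t *\<^sub>R y)\<bar>) \<le>
      expectation (\<lambda>\<omega>. (1 - t) * \<bar>Z \<omega> - x\<bar> + t * \<bar>Z \<omega> - y\<bar>)"
    proof (rule integral_mono)
      fix \<omega>
      have "Z \<omega> - ((1 - t) *\<^sub>R x + t *\<^sub>R y) = (1 - t) * (Z \<omega> - x) + t * (Z \<omega> - y)"
        by (simp add: algebra_simps)
      also have "\<bar>\<dots>\<bar> \<le> \<bar>(1 - t) * (Z \<omega> - x)\<bar> + \<bar>t * (Z \<omega> - y)\<bar>"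
        by (rule abs_triangle_ineq)
      also have "\<dots> = (1 - t) * \<bar>Z \<omega> - x\<bar> + t * \<bar>Z \<omega> - y\<bar>"
        using t by (simp add: abs_mult)
      finally show "\<bar>Z \<omega> - ((1 - t) *\<^sub>R x + t *\<^sub>R y)\<bar> \<le> (1 - t) * \<bar>Z \<omega> - x\<bar> + t * \<bar>Z \<omega> - y\<bar>" .
    qed (use Z in auto)
    also have "\<dots> = (1 - t) * expectation (\<lambda>\<omega>. \<bar>Z \<omega> - x\<bar>) + t * expectation (\<lambda>\<omega>. \<bar>Z \<omega> - y\<bar>)"
      using Z by (subst Bochner_Integration.integral_add) auto
    finally show "expectation (\<lambda>\<omega>. \<bar>Z \<omega> - ((1 - t) *\<^sub>R x + t *\<^sub>R y)\<bar>) \<le>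
      (1 - t) * expectation (\<lambda>\<omega>. \<bar>Z \<omega> - x\<bar>) + t * expectation (\<lambda>\<omega>. \<bar>Z \<omega> - y\<bar>)" .
  qed simp
  have "expectation (\<lambda>\<omega>. \<bar>Z \<omega> - x\<bar>) \<le> expectation (\<lambda>\<omega>. \<bar>Z \<omega> - y\<bar> + \<bar>x - y\<bar>)"
    using Z by (intro integral_mono) auto
  also have "\<dots> = expectation (\<lambda>\<omega>. \<bar>Z \<omega> - y\<bar>) + \<bar>x - y\<bar>"
    using Z by (subst Bochner_Integration.integral_add) (auto simp: prob_space)
  finally show "expectation (\<lambda>\<omega>. \<bar>Z \<omega> - x\<bar>) \<le> expectation (\<lambda>\<omega>. \<bar>Z \<omega> - y\<bar>) + \<bar>x - y\<bar>" .
qed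

section \<open>Laws at stopping times\<close>

text \<open>The right difference quotient of \<bar>y - x\<bar> in \<open>x\<close> is bounded by 1
  and tends to 1 for \<open>y \<le> x\<close> and to -1 for \<open>y > x\<close>. Its integral
  therefore tends to \<open>2 * cdf \<rho> x - 1\<close>, so the hypothesis determines the
  distribution function.\<close>

lemma real_distribution_eqI_abs:
  fixes \<mu> \<nu> :: "real measure"
  assumes \<mu>: "real_distribution \<mu>" and \<nu>: "real_distribution \<nu>"
    and eq: "\<And>x h. 0 < h \<Longrightarrow>
      (\<integral>y. \<bar>y - (x + h)\<bar> - \<bar>y - x\<bar> \<partial>\<mu>) = (\<integral>y. \<bar>y - (x + h)\<bar> - \<bar>y - x\<bar> \<partial>\<nu>)"
  shows "\<mu> = \<nu>"
proof (rule cdf_unique[OF \<mu> \<nu>], rule ext)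
  fix x
  let ?q = "\<lambda>n y. (\<bar>y - (x + 1 / real (Suc n))\<bar> - \<bar>y - x\<bar>) * real (Suc n)"
  have lim: "(\<lambda>n. \<integral>y. ?q n y \<partial>\<rho>) \<longlonglongrightarrow> 2 * cdf \<rho> x - 1" if "real_distribution \<rho>" for \<rho>
  proof -
    interpret \<rho>: real_distribution \<rho>
      by fact
    have "(\<lambda>n. \<integral>y. ?q n y \<partial>\<rho>) \<longlonglongrightarrow> (\<integral>y. 2 * indicator {..x} y - 1 \<partial>\<rho>)"
    proof (rule integral_dominated_convergence[where w="\<lambda>_. 1"])
      show "AE y in \<rho>. (\<lambda>n. ?q n y) \<longlonglongrightarrow> 2 * indicator {..x} y - 1"
      proof (intro AE_I2 tendsto_eventually)
        fix y
        show "\<forall>\<^sub>F n in sequentially. ?q n y = 2 * indicator {..x} y - 1"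
        proof (cases "y \<le> x")
          case True
          have "?q n y = 1" for n
          proof -
            have "0 < 1 / real (Suc n)"
              by simp
            with True have "\<bar>y - (x + 1 / real (Suc n))\<bar> - \<bar>y - x\<bar> = 1 / real (Suc n)"
              by linarith
            then show ?thesis
              by simp
          qed
          then show ?thesis
            using True by simp
        next
          case False
          then have "\<forall>\<^sub>F n in sequentially. 1 / real (Suc n) < y - x"
            using order_tendstoD(2)[OF LIMSEQ_Suc[OF lim_const_over_n[of 1]], of "y - x"] by simp
          then show ?thesis
          proof eventually_elim
            case (elim n)
            then have "\<bar>y - (x + 1 / real (Suc n))\<bar> - \<bar>y - x\<bar> = - (1 / real (Suc n))"
              using False by linarith
            then have "?q n y = - 1"
              by simp
            then show ?case
              using False by simp
          qed
        qed
      qed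
      show "AE y in \<rho>. norm (?q n y) \<le> 1" for n
      proof (rule AE_I2)
        fix y
        have "\<bar>\<bar>y - (x + 1 / real (Suc n))\<bar> - \<bar>y - x\<bar>\<bar> \<le> 1 / real (Suc n)"
          using divide_nonneg_nonneg[of 1 "real (Suc n)"] by linarith
        then show "norm (?q n y) \<le> 1"
          by (simp add: abs_mult pos_le_divide_eq del: of_nat_Suc)
      qed
    qed simp_all
    also have "(\<integral>y. 2 * indicator {..x} y - 1 \<partial>\<rho>) = 2 * cdf \<rho> x - 1"
      using \<rho>.prob_space
      by (subst Bochner_Integration.integral_diff) (auto simp: cdf_def \<rho>.emeasure_eq_measure)
    finally show ?thesis .
  qed
  have "(\<integral>y. ?q n y \<partial>\<mu>) = (\<integral>y. ?q n y \<partial>\<nu>)" for n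
    using eq[of "1 / real (Suc n)" x] by simp
  then have "(\<lambda>n. \<integral>y. ?q n y \<partial>\<nu>) \<longlonglongrightarrow> 2 * cdf \<mu> x - 1"
    using lim[OF \<mu>] by (simp only:)
  from LIMSEQ_unique[OF this lim[OF \<nu>]] show "cdf \<mu> x = cdf \<nu> x"
    by simp
qed

section \<open>Values of the path at stopping times, and almost sure finiteness\<close>

context brownian_motion
begin

text \<open>The variable whose law \<open>embeds\<close> speaks about; where \<open>\<tau>\<close>
  is infinite it has the dummy value \<open>B 0\<close>.\<close>

definition terminal :: "('a \<Rightarrow> ereal) \<Rightarrow> 'a \<Rightarrow> real" where
  "terminal \<tau> \<omega> = B (real_of_ereal (\<tau> \<omega>)) \<omega>"

lemma stopped_eq_terminal:
  "\<tau> \<omega> \<le> ereal t \<Longrightarrow> stopped \<tau> t \<omega> = terminal \<tau> \<omega>"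
  by (simp add: stopped_def terminal_def min_absorb1)

lemma measurable_terminal:
  assumes "\<tau> \<in> borel_measurable M" "\<And>\<omega>. \<omega> \<in> space M \<Longrightarrow> 0 \<le> \<tau> \<omega>"
  shows "terminal \<tau> \<in> borel_measurable M"
  unfolding terminal_def[abs_def]
  by (rule measurable_at_time(1)) (use assms in \<open>auto intro: real_of_ereal_pos\<close>)

lemma measurable_stopped:
  assumes "\<tau> \<in> borel_measurable M" "\<And>\<omega>. \<omega> \<in> space M \<Longrightarrow> 0 \<le> \<tau> \<omega>" "0 \<le> t"
  shows "stopped \<tau> t \<in> borel_measurable M"
  unfolding stopped_def[abs_def]
  by (rule measurable_at_time(1)) (use assms in \<open>auto intro: real_of_ereal_pos\<close>)

lemma tendsto_path:
  assumes \<omega>: "\<omega> \<in> space M" and X: "X \<longlonglongrightarrow> X0" and nonneg: "\<And>n. 0 \<le> X n"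
    and fin: "X0 < \<infinity>"
  shows "(\<lambda>n. B (real_of_ereal (X n)) \<omega>) \<longlonglongrightarrow> B (real_of_ereal X0) \<omega>"
proof -
  have "0 \<le> X0"
    by (rule LIMSEQ_le_const[OF X]) (use nonneg in auto)
  then obtain s where s: "X0 = ereal s" "0 \<le> s"
    using fin by (cases X0) auto
  have "(\<lambda>n. real_of_ereal (X n)) \<longlonglongrightarrow> s"
    using X unfolding s by (rule lim_real_of_ereal)
  then have "(\<lambda>n. B (real_of_ereal (X n)) \<omega>) \<longlonglongrightarrow> B s \<omega>"
    by (rule continuous_on_tendsto_compose[OF continuous_paths[OF \<omega>]])
      (use s nonneg in \<open>auto intro: real_of_ereal_pos always_eventually\<close>)
  then show ?thesis
    by (simp add: s)
qed

lemma terminal_entry_time: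
  assumes \<omega>: "\<omega> \<in> space M" and J: "open J" and \<tau>: "0 \<le> \<tau> \<omega>"
    and fin: "entry_time \<tau> (- J) \<omega> < \<infinity>"
  shows "terminal (entry_time \<tau> (- J)) \<omega> \<notin> J"
    and "terminal (entry_time \<tau> (- J)) \<omega> = terminal \<tau> \<omega> \<or>
      terminal (entry_time \<tau> (- J)) \<omega> \<in> closure J \<and> terminal \<tau> \<omega> \<in> closure J"
proof -
  let ?\<sigma> = "entry_time \<tau> (- J)"
  have F: "closed (- J)"
    using J by (rule closed_Compl)
  obtain s where s: "?\<sigma> \<omega> = ereal s" "0 \<le> s" "\<tau> \<omega> \<le> ereal s" "B s \<omega> \<in> - J"
    by (cases rule: entry_time_cases[OF \<omega> F, of \<tau>]) (use fin in auto)
  show "terminal ?\<sigma> \<omega> \<notin> J"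
    using s by (simp add: terminal_def)
  \<comment> \<open>Stopping at the finite entry time \<open>s\<close> changes neither value, so the
    comparison at bounded times applies.\<close>
  have "stopped ?\<sigma> s \<omega> = terminal ?\<sigma> \<omega>" "stopped \<tau> s \<omega> = terminal \<tau> \<omega>"
    using s by (simp_all add: stopped_eq_terminal)
  then show "terminal ?\<sigma> \<omega> = terminal \<tau> \<omega> \<or> terminal ?\<sigma> \<omega> \<in> closure J \<and> terminal \<tau> \<omega> \<in> closure J"
    using stopped_entry_time[where \<tau>=\<tau> and J=J, OF \<omega> J \<tau> s(2)] by simp
qed

text \<open>Between the two times the path is confined to the closure of \<open>J\<close>, so the
  difference of the stopped values is bounded by the length of the interval. Dominated convergence
  is applied to this difference, which has mean zero at each bounded time.\<close>

lemma terminal_entry_time_bounded: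
  assumes \<tau>: "stopping \<tau>" and B0: "integrable M (B 0)" and J: "open J" "J \<subseteq> {a..b}"
    and fin: "AE \<omega> in M. entry_time \<tau> (- J) \<omega> < \<infinity>" and Z: "integrable M (terminal \<tau>)"
  shows "integrable M (terminal (entry_time \<tau> (- J)))"
    and "expectation (terminal (entry_time \<tau> (- J))) = expectation (terminal \<tau>)"
proof -
  let ?\<sigma> = "entry_time \<tau> (- J)"
  have \<sigma>: "stopping ?\<sigma>"
    by (rule stopping_entry_time[OF \<tau> closed_Compl[OF J(1)]])
  have nonneg: "0 \<le> \<tau> \<omega>" "0 \<le> ?\<sigma> \<omega>" if "\<omega> \<in> space M" for \<omega>
    using \<tau> \<sigma> that by (simp_all add: stopping_def)
  have le: "\<tau> \<omega> \<le> ?\<sigma> \<omega>" if "\<omega> \<in> space M" for \<omega>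
    by (rule entry_time_ge[OF that closed_Compl[OF J(1)]])
  have closure: "closure J \<subseteq> {a..b}"
    using J(2) by (rule closure_minimal) simp
  have bound: "\<bar>stopped ?\<sigma> t \<omega> - stopped \<tau> t \<omega>\<bar> \<le> \<bar>b - a\<bar>" if \<omega>: "\<omega> \<in> space M" and "0 \<le> t" for \<omega> t
    using stopped_entry_time[where \<tau>=\<tau> and J=J, OF \<omega> J(1) nonneg(1)[OF \<omega>] that(2)]
  proof
    assume "stopped ?\<sigma> t \<omega> \<in> closure J \<and> stopped \<tau> t \<omega> \<in> closure J"
    with closure have "stopped ?\<sigma> t \<omega> \<in> {a..b}" "stopped \<tau> t \<omega> \<in> {a..b}"
      by blast+
    then show ?thesis
      by auto
  qed simp
  have meas: "terminal ?\<sigma> \<in> borel_measurable M"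
    by (rule measurable_terminal[OF stopping_measurable[OF \<sigma>] nonneg(2)])
  have int: "integrable M (stopped ?\<sigma> (real n))" "integrable M (stopped \<tau> (real n))" for n
    using integrable_stopped[OF \<sigma> _ B0] integrable_stopped[OF \<tau> _ B0] by simp_all
  have lim: "AE \<omega> in M. (\<lambda>n. stopped ?\<sigma> (real n) \<omega> - stopped \<tau> (real n) \<omega>) \<longlonglongrightarrow> terminal ?\<sigma> \<omega> - terminal \<tau> \<omega>"
    using fin AE_space
  proof eventually_elim
    case (elim \<omega>)
    obtain s where s: "?\<sigma> \<omega> = ereal s"
      using elim nonneg(2)[of \<omega>] by (cases "?\<sigma> \<omega>") auto
    obtain N where N: "s \<le> real N"
      using real_arch_simple by blast
    show ?case
    proof (rule tendsto_eventually, rule eventually_sequentiallyI[of N])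
      fix n assume "N \<le> n"
      then have n: "?\<sigma> \<omega> \<le> ereal (real n)"
        using N s by simp
      then have "\<tau> \<omega> \<le> ereal (real n)"
        using le[of \<omega>] elim by (meson order_trans)
      with n show "stopped ?\<sigma> (real n) \<omega> - stopped \<tau> (real n) \<omega> = terminal ?\<sigma> \<omega> - terminal \<tau> \<omega>"
        by (simp only: stopped_eq_terminal)
    qed
  qed
  have meas_lim: "(\<lambda>\<omega>. terminal ?\<sigma> \<omega> - terminal \<tau> \<omega>) \<in> borel_measurable M"
    using meas borel_measurable_integrable[OF Z] by (rule borel_measurable_diff)
  have meas_n: "(\<lambda>\<omega>. stopped ?\<sigma> (real n) \<omega> - stopped \<tau> (real n) \<omega>) \<in> borel_measurable M" for n
    by (intro borel_measurable_diff borel_measurable_integrable int)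
  have dominated: "AE \<omega> in M. norm (stopped ?\<sigma> (real n) \<omega> - stopped \<tau> (real n) \<omega>) \<le> \<bar>b - a\<bar>" for n
    unfolding real_norm_def by (rule AE_I2) (rule bound, assumption, simp)
  have dom: "integrable M (\<lambda>\<omega>. terminal ?\<sigma> \<omega> - terminal \<tau> \<omega>)"
    by (rule integrable_dominated_convergence[OF meas_lim meas_n integrable_const lim dominated])
  have conv: "(\<lambda>n. expectation (\<lambda>\<omega>. stopped ?\<sigma> (real n) \<omega> - stopped \<tau> (real n) \<omega>)) \<longlonglongrightarrow>
      expectation (\<lambda>\<omega>. terminal ?\<sigma> \<omega> - terminal \<tau> \<omega>)"
    by (rule integral_dominated_convergence[OF meas_lim meas_n integrable_const lim dominated])
  have "expectation (\<lambda>\<omega>. stopped ?\<sigma> (real n) \<omega> - stopped \<tau> (real n) \<omega>) = 0" for n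
    using int expectation_stopped[OF \<sigma> _ B0, of "real n"] expectation_stopped[OF \<tau> _ B0, of "real n"]
    by simp
  with conv have zero: "expectation (\<lambda>\<omega>. terminal ?\<sigma> \<omega> - terminal \<tau> \<omega>) = 0"
    by (simp add: LIMSEQ_const_iff)
  from Bochner_Integration.integrable_add[OF dom Z] show I: "integrable M (terminal ?\<sigma>)"
    by simp
  show "expectation (terminal ?\<sigma>) = expectation (terminal \<tau>)"
    using zero I Z by simp
qed

text \<open>On \<open>\<tau> = \<infinity>\<close> the stopped path is \<open>B\<^sub>t\<close>, which leaves every bounded set in probability.\<close>

lemma AE_finite_of_stopped_bounded:
  assumes \<tau>: "\<tau> \<in> borel_measurable M" "\<And>\<omega>. \<omega> \<in> space M \<Longrightarrow> 0 \<le> \<tau> \<omega>" and B0: "integrable M (B 0)"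
    and int: "\<And>t. 0 \<le> t \<Longrightarrow> integrable M (stopped \<tau> t)"
    and bound: "\<And>t. 0 \<le> t \<Longrightarrow> expectation (\<lambda>\<omega>. \<bar>stopped \<tau> t \<omega>\<bar>) \<le> c"
  shows "AE \<omega> in M. \<tau> \<omega> < \<infinity>"
proof -
  let ?E = "{\<omega> \<in> space M. \<tau> \<omega> = \<infinity>}"
  define k where "k = c + expectation (\<lambda>\<omega>. \<bar>B 0 \<omega>\<bar>)"
  have E: "?E \<in> events"
    using \<tau>(1) by measurable
  have small: "prob ?E \<le> (k + 2) / K" if K: "0 < K" for K
  proof -
    \<comment> \<open>Then \<open>K\<^sup>2 \<le> sqrt (2 * pi * t)\<close>, and the probability of
      an increment of size at most \<open>K\<close> is at most \<open>2 / K\<close>.\<close>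
    define t where "t = K ^ 4"
    have t: "0 < t"
      using K by (simp add: t_def)
    let ?D = "\<lambda>\<omega>. \<bar>stopped \<tau> t \<omega> - B 0 \<omega>\<bar>"
    let ?F = "{\<omega> \<in> space M. K \<le> ?D \<omega>}" and ?G = "{\<omega> \<in> space M. \<bar>B t \<omega> - B 0 \<omega>\<bar> \<le> K}"
    have intD: "integrable M ?D"
      using int[of t] t B0 by simp
    have [measurable]: "stopped \<tau> t \<in> borel_measurable M" "B 0 \<in> borel_measurable M" "B t \<in> borel_measurable M"
      using int[of t] B0 random_variable_B[of t] t by auto
    have FG: "?F \<in> events" "?G \<in> events"
      by measurable
    \<comment> \<open>On \<open>?E\<close> the stopped value is \<open>B t\<close>, so its
      displacement from \<open>B 0\<close> is either large, which Markov's inequality controls, or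
      small, which the density bound controls.\<close>
    have "?E \<subseteq> ?F \<union> ?G"
      by (auto simp: stopped_def)
    then have "prob ?E \<le> prob (?F \<union> ?G)"
      using FG by (intro finite_measure_mono) auto
    also have "\<dots> \<le> prob ?F + prob ?G"
      using FG by (rule measure_Un_le)
    also have "prob ?F \<le> expectation ?D / K"
      by (rule integral_Markov_inequality_measure[where A="{}"]) (use intD K in auto)
    also have "expectation ?D \<le> expectation (\<lambda>\<omega>. \<bar>stopped \<tau> t \<omega>\<bar> + \<bar>B 0 \<omega>\<bar>)"
      using int[of t] t B0 by (intro integral_mono) auto
    also have "\<dots> \<le> k"
      using int[of t] t B0 bound[of t] by (simp add: k_def)
    also have "prob ?G \<le> 2 * K / sqrt (2 * pi * t)"
      using prob_increment_small[of 0 t K] t K by simp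
    also have "\<dots> \<le> 2 * K / K\<^sup>2"
    proof (intro divide_left_mono)
      have "(K\<^sup>2)\<^sup>2 = 1 * t"
        by (simp add: t_def power_mult[symmetric])
      also have "\<dots> \<le> (2 * pi) * t"
        using t pi_gt3 by (intro mult_right_mono) auto
      finally show "K\<^sup>2 \<le> sqrt (2 * pi * t)"
        by (rule real_le_rsqrt)
    qed (use K t in auto)
    also have "\<dots> = 2 / K"
      using K by (simp add: power2_eq_square)
    finally show ?thesis
      using K by (simp add: add_divide_distrib divide_right_mono)
  qed
  have "prob ?E \<le> 0"
  proof (rule LIMSEQ_le_const)
    show "(\<lambda>n. (k + 2) / real (Suc n)) \<longlonglongrightarrow> 0"
      by (rule LIMSEQ_Suc[OF lim_const_over_n])
    show "\<exists>N. \<forall>n\<ge>N. prob ?E \<le> (k + 2) / real (Suc n)"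
      using small by (intro exI[of _ 0] allI impI) simp
  qed
  then have "prob ?E = 0"
    by (simp add: measure_le_0_iff)
  then have "AE \<omega> in M. \<omega> \<notin> ?E"
    using prob_eq_0[OF E] by simp
  then show ?thesis
    using AE_space by eventually_elim (auto simp: less_top)
qed

end

section \<open>The embedding\<close>

lemma
  fixes u :: "real \<Rightarrow> real"
  shows g_seq_le: "1 \<le> n \<Longrightarrow> g_seq u f n x \<le> f n x"
    and g_seq_decseq: "decseq (\<lambda>n. g_seq u f n x)"
  by (cases n; simp) (rule decseq_SucI, simp)

text \<open>A decreasing sequence converges to its infimum, here \<open>g_inf\<close>; the
  assumption that this is a real number brings the limit back from \<open>ereal\<close>.\<close>

lemma g_seq_tendsto:
  assumes "g_inf u f x = ereal y"
  shows "(\<lambda>n. g_seq u f n x) \<longlonglongrightarrow> y"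
proof -
  have "(INF n. ereal (g_seq u f n x)) = g_inf u f x"
  proof (rule antisym)
    have "(INF n. ereal (g_seq u f n x)) \<le> ereal (f n x)" if "n \<in> {1..}" for n
      using g_seq_le[of n u f x] that by (intro INF_lower2[of n]) auto
    moreover have "(INF n. ereal (g_seq u f n x)) \<le> ereal (u x)"
      by (rule INF_lower2[of 0]) auto
    ultimately show "(INF n. ereal (g_seq u f n x)) \<le> g_inf u f x"
      unfolding g_inf_def by (intro min.boundedI INF_greatest)
    have "g_inf u f x \<le> ereal (g_seq u f n x)" for n
    proof (induction n)
      case (Suc n)
      have "g_inf u f x \<le> ereal (f (Suc n) x)"
        unfolding g_inf_def by (intro min.coboundedI1 INF_lower) auto
      with Suc show ?case
        by (simp add: min_def)
    qed (simp add: g_inf_def)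
    then show "g_inf u f x \<le> (INF n. ereal (g_seq u f n x))"
      by (rule INF_greatest)
  qed
  moreover have "(\<lambda>n. ereal (g_seq u f n x)) \<longlonglongrightarrow> (INF n. ereal (g_seq u f n x))"
    using g_seq_decseq[of u f x] by (intro LIMSEQ_INF) (auto simp: decseq_def)
  ultimately show ?thesis
    using assms by simp
qed

text \<open>The derivative bound of the theorem is restated as a bound on the linear coefficient,
  the form used in the analysis of contact sets.\<close>

locale affine_exit_times = brownian_motion +
  fixes f :: "nat \<Rightarrow> real \<Rightarrow> real"
  assumes integrable_B0: "integrable M (B 0)"
    and affine_slope_le_1: "\<And>n. 1 \<le> n \<Longrightarrow> \<exists>c d. \<bar>c\<bar> \<le> 1 \<and> (\<forall>x. f n x = c * x + d)"
begin

text \<open>The potential of the law of \<open>B 0\<close>, written as an expectation on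
  \<open>M\<close>.\<close>

definition u :: "real \<Rightarrow> real" where
  "u x = - expectation (\<lambda>\<omega>. \<bar>B 0 \<omega> - x\<bar>)"

abbreviation g :: "nat \<Rightarrow> real \<Rightarrow> real" where
  "g \<equiv> g_seq u f"

abbreviation T :: "nat \<Rightarrow> 'a \<Rightarrow> ereal" where
  "T \<equiv> exit_time B u f"

abbreviation T_lim :: "'a \<Rightarrow> ereal" where
  "T_lim \<equiv> limit_time B u f"

text \<open>The index is shifted: \<open>contact n\<close> governs the step from \<open>T n\<close>
  to \<open>T (Suc n)\<close>.\<close>

abbreviation contact :: "nat \<Rightarrow> real set" where
  "contact n \<equiv> {x. f (Suc n) x < g n x}"

lemma concave_g: "concave_on UNIV (g n)"
proof (induction n)
  case 0
  have "convex_on UNIV (\<lambda>x. expectation (\<lambda>\<omega>. \<bar>B 0 \<omega> - x\<bar>))"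
    by (rule convex_on_expectation_abs[OF prob_space_axioms integrable_B0])
  then show ?case
    by (simp add: concave_on_def u_def)
next
  case (Suc n)
  obtain c d where f: "f (Suc n) = (\<lambda>x. c * x + d)"
    using affine_slope_le_1[of "Suc n"] by fastforce
  have "concave_on UNIV (f (Suc n))"
    unfolding f concave_on_iff
  proof (intro conjI ballI allI impI)
    fix x y s t :: real
    assume "s + t = 1"
    then have "s * d + t * d = d"
      by (simp add: distrib_right[symmetric])
    then show "s * (c * x + d) + t * (c * y + d) \<le> c * (s *\<^sub>R x + t *\<^sub>R y) + d"
      by (simp add: algebra_simps)
  qed simp
  with Suc show ?case
    using concave_on_min[of "g n" "f (Suc n)"] by simp
qed

text \<open>Supplies the constant \<open>K\<close> for \<open>contact_set_cases\<close>; it follows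
  from \<bar>x\<bar> - \<bar>B 0\<bar> \<le> \<bar>B 0 - x\<bar>.\<close>

lemma g_le: "g n x \<le> expectation (\<lambda>\<omega>. \<bar>B 0 \<omega>\<bar>) - \<bar>x\<bar>"
proof -
  have "g n x \<le> g 0 x"
    using g_seq_decseq[of u f x] by (simp only: decseq_def)
  also have "\<dots> = - expectation (\<lambda>\<omega>. \<bar>B 0 \<omega> - x\<bar>)"
    by (simp add: u_def)
  also have "\<dots> \<le> - expectation (\<lambda>\<omega>. \<bar>x\<bar> - \<bar>B 0 \<omega>\<bar>)"
    using integrable_B0 by (intro le_imp_neg_le integral_mono) auto
  also have "\<dots> = expectation (\<lambda>\<omega>. \<bar>B 0 \<omega>\<bar>) - \<bar>x\<bar>"
    using integrable_B0 by (simp add: prob_space)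
  finally show ?thesis .
qed

lemma open_contact: "open (contact n)" and convex_contact: "convex (contact n)"
proof -
  obtain c d where "\<And>x. f (Suc n) x = c * x + d"
    using affine_slope_le_1[of "Suc n"] by auto
  from open_contact_set[OF concave_g this] convex_contact_set[OF concave_g this]
  show "open (contact n)" "convex (contact n)" .
qed

text \<open>The contact set is open and convex, so it equals the interval between its infimum and
  supremum. An empty contact set gives an empty interval and fits the same formula.\<close>

lemma exit_time_Suc: "T (Suc n) = entry_time (T n) (- contact n)"
proof
  fix \<omega>
  have "{left_end u f (Suc n)<..<right_end u f (Suc n)} =
    {x. Inf (ereal ` contact n) < x \<and> x < Sup (ereal ` contact n)}"
    by (auto simp: left_end_def right_end_def)
  then have "ereal x \<notin> {left_end u f (Suc n)<..<right_end u f (Suc n)} \<longleftrightarrow> x \<in> - contact n" for x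
    using open_convex_eq_ereal_interval[OF open_contact convex_contact, of n] by auto
  then show "T (Suc n) \<omega> = entry_time (T n) (- contact n) \<omega>"
    unfolding entry_time_def exit_time.simps by simp
qed

lemma closed_contact: "closed (- contact n)"
  by (rule closed_Compl[OF open_contact])

section \<open>The exit times and their limit\<close>

lemma stopping_T: "stopping (T n)"
proof (induction n)
  case 0
  have "{\<omega> \<in> space M. T 0 \<omega> \<le> ereal s} = space (past s)" if "0 \<le> s" for s
    using that by (auto simp: zero_ereal_def)
  then show ?case
    by (auto simp: stopping_def simp del: space_past)
next
  case (Suc n)
  then show ?case
    unfolding exit_time_Suc by (rule stopping_entry_time[OF _ closed_contact])
qed

lemma T_nonneg: "\<omega> \<in> space M \<Longrightarrow> 0 \<le> T n \<omega>"
  using stopping_T[of n] by (simp add: stopping_def)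

lemma incseq_T: "\<omega> \<in> space M \<Longrightarrow> incseq (\<lambda>n. T n \<omega>)"
  by (rule incseq_SucI) (simp only: exit_time_Suc entry_time_ge[OF _ closed_contact])

text \<open>A monotone sequence in \<open>ereal\<close> always converges, possibly to \<infinity>,
  so \<open>lim\<close> denotes a true limit.\<close>

lemma T_tendsto: "\<omega> \<in> space M \<Longrightarrow> (\<lambda>n. T n \<omega>) \<longlonglongrightarrow> T_lim \<omega>"
  unfolding limit_time_def
  using LIMSEQ_SUP[OF incseq_T] convergent_LIMSEQ_iff convergentI by blast

lemma T_le_lim: "\<omega> \<in> space M \<Longrightarrow> T n \<omega> \<le> T_lim \<omega>"
  by (rule incseq_le[OF incseq_T T_tendsto])

lemma T_lim_nonneg: "\<omega> \<in> space M \<Longrightarrow> 0 \<le> T_lim \<omega>"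
  by (rule order_trans[OF T_nonneg T_le_lim])

lemma measurable_T_lim: "T_lim \<in> borel_measurable M"
proof -
  have [measurable]: "T n \<in> borel_measurable M" for n
    by (rule stopping_measurable[OF stopping_T])
  show ?thesis
    unfolding limit_time_def[abs_def] by measurable
qed

text \<open>Off the contact set a step leaves the mean distance unchanged; inside, convexity and the
  Lipschitz bound take over. Equality cannot be expected inside, as the path may still be in the
  contact set at time \<open>t\<close>.\<close>

lemma expectation_abs_stopped_le:
  assumes t: "0 \<le> t"
  shows "expectation (\<lambda>\<omega>. \<bar>stopped (T n) t \<omega> - x\<bar>) \<le> - g n x"
proof (induction n arbitrary: x)
  case 0
  have "stopped (T 0) t = B 0"
    using t by (simp add: stopped_def[abs_def] min_absorb1)
  then show ?case
    by (simp add: u_def)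
next
  case (Suc n)
  obtain c d where c: "\<bar>c\<bar> \<le> 1" and f: "\<And>x. f (Suc n) x = c * x + d"
    using affine_slope_le_1[of "Suc n"] by auto
  note int = integrable_stopped[OF stopping_T[of "Suc n"] t integrable_B0]
  have "expectation (\<lambda>\<omega>. \<bar>stopped (T (Suc n)) t \<omega> - x\<bar>) \<le> - min (g n x) (f (Suc n) x)"
  proof (rule le_uminus_min_of_contact_set[OF concave_g g_le f c])
    show "convex_on UNIV (\<lambda>x. expectation (\<lambda>\<omega>. \<bar>stopped (T (Suc n)) t \<omega> - x\<bar>))"
      by (rule convex_on_expectation_abs[OF prob_space_axioms int])
    show "expectation (\<lambda>\<omega>. \<bar>stopped (T (Suc n)) t \<omega> - x\<bar>) \<le>
      expectation (\<lambda>\<omega>. \<bar>stopped (T (Suc n)) t \<omega> - y\<bar>) + \<bar>x - y\<bar>" for x y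
      by (rule expectation_abs_lipschitz[OF prob_space_axioms int])
    show "expectation (\<lambda>\<omega>. \<bar>stopped (T (Suc n)) t \<omega> - x\<bar>) \<le> - g n x" if "\<not> f (Suc n) x < g n x" for x
      unfolding exit_time_Suc
      using expectation_abs_stopped_entry_time[OF stopping_T t integrable_B0 open_contact convex_contact, of x n n] that
        Suc[of x] by simp
  qed
  then show ?case
    by simp
qed

text \<open>At \<open>x = 0\<close> the preceding bound controls the first moment uniformly in
  \<open>n\<close> and \<open>t\<close>, and Fatou along \<open>n\<close> transfers it to the path
  stopped at \<open>T_lim\<close>.\<close>

lemma AE_T_lim_finite:
  assumes c: "\<And>n. c \<le> g n 0"
  shows "AE \<omega> in M. T_lim \<omega> < \<infinity>"
proof (rule AE_finite_of_stopped_bounded[OF measurable_T_lim T_lim_nonneg integrable_B0, where c="- c"])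
  fix t :: real assume t: "0 \<le> t"
  have meas: "stopped T_lim t \<in> borel_measurable M"
    by (rule measurable_stopped[OF measurable_T_lim T_lim_nonneg t])
  have lim: "AE \<omega> in M. (\<lambda>n. stopped (T n) t \<omega>) \<longlonglongrightarrow> stopped T_lim t \<omega>"
    unfolding stopped_def
  proof (rule AE_I2)
    fix \<omega> assume \<omega>: "\<omega> \<in> space M"
    show "(\<lambda>n. B (real_of_ereal (min (T n \<omega>) (ereal t))) \<omega>) \<longlonglongrightarrow> B (real_of_ereal (min (T_lim \<omega>) (ereal t))) \<omega>"
    proof (rule tendsto_path[OF \<omega>])
      show "(\<lambda>n. min (T n \<omega>) (ereal t)) \<longlonglongrightarrow> min (T_lim \<omega>) (ereal t)"
        by (intro tendsto_min T_tendsto[OF \<omega>] tendsto_const)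
      show "0 \<le> min (T n \<omega>) (ereal t)" for n
        using T_nonneg[OF \<omega>] t by simp
      show "min (T_lim \<omega>) (ereal t) < \<infinity>"
        by (rule le_less_trans[OF min.cobounded2]) simp
    qed
  qed
  have bound: "expectation (\<lambda>\<omega>. \<bar>stopped (T n) t \<omega>\<bar>) \<le> - c" for n
    using expectation_abs_stopped_le[OF t, of n 0] c[of n] by simp
  note int = integrable_stopped[OF stopping_T t integrable_B0]
  show "integrable M (stopped T_lim t)"
    by (rule integrable_abs_of_tendsto(1)[where X="\<lambda>n. stopped (T n) t", OF int meas lim bound])
  show "expectation (\<lambda>\<omega>. \<bar>stopped T_lim t \<omega>\<bar>) \<le> - c"
    by (rule integrable_abs_of_tendsto(2)[where X="\<lambda>n. stopped (T n) t", OF int meas lim bound])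
qed

text \<open>The value at \<open>T (Suc n)\<close> avoids the contact set, so its distance from
  \<open>x\<close> is affine in \<open>x\<close> there, as \<open>f (Suc n)\<close> is. Off the
  contact set the mean distance changes by one constant for all \<open>x\<close>: zero for a bounded
  set, up to sign the shift of the mean for a half-line.\<close>

lemma terminal_step:
  assumes fin: "AE \<omega> in M. T (Suc n) \<omega> < \<infinity>" and Z: "integrable M (terminal (T n))"
    and pot: "\<And>x. expectation (\<lambda>\<omega>. \<bar>terminal (T n) \<omega> - x\<bar>) = C - g n x"
  shows "integrable M (terminal (T (Suc n))) \<and>
    (\<exists>C'. \<forall>x. expectation (\<lambda>\<omega>. \<bar>terminal (T (Suc n)) \<omega> - x\<bar>) = C' - g (Suc n) x)"
proof -
  let ?Z = "terminal (T n)" and ?Z' = "terminal (T (Suc n))"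
  obtain c d where c: "\<bar>c\<bar> \<le> 1" and f: "\<And>x. f (Suc n) x = c * x + d"
    using affine_slope_le_1[of "Suc n"] by auto
  have meas: "?Z' \<in> borel_measurable M"
    by (rule measurable_terminal[OF stopping_measurable[OF stopping_T] T_nonneg])
  have exit: "AE \<omega> in M. ?Z' \<omega> \<notin> contact n \<and>
    (?Z' \<omega> = ?Z \<omega> \<or> ?Z' \<omega> \<in> closure (contact n) \<and> ?Z \<omega> \<in> closure (contact n))"
    using fin AE_space
  proof eventually_elim
    case (elim \<omega>)
    then show ?case
      using terminal_entry_time[where \<tau>="T n" and J="contact n", OF _ open_contact T_nonneg]
      unfolding exit_time_Suc by blast
  qed
  have cong: "expectation (\<lambda>\<omega>. \<bar>?Z' \<omega> - x\<bar>) = expectation h"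
    if "AE \<omega> in M. \<bar>?Z' \<omega> - x\<bar> = h \<omega>" "h \<in> borel_measurable M" for x h
    using that meas by (intro integral_cong_AE) auto
  have Z_meas: "?Z \<in> borel_measurable M"
    using Z by auto
  show ?thesis
  proof (cases rule: contact_set_cases[OF concave_g[of n] g_le f c])
    case 1
    then have eq: "AE \<omega> in M. ?Z' \<omega> = ?Z \<omega>"
      using exit by simp
    have "integrable M ?Z'"
      using integrable_cong_AE[OF meas Z_meas eq] Z by simp
    moreover have "expectation (\<lambda>\<omega>. \<bar>?Z' \<omega> - x\<bar>) = C - g (Suc n) x" for x
    proof -
      have "expectation (\<lambda>\<omega>. \<bar>?Z' \<omega> - x\<bar>) = expectation (\<lambda>\<omega>. \<bar>?Z \<omega> - x\<bar>)"
        by (rule cong) (use eq Z_meas in auto)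
      moreover have "g (Suc n) x = g n x"
        using 1 by (auto simp: min_def not_less[symmetric])
      ultimately show ?thesis
        using pot by simp
    qed
    ultimately show ?thesis
      by blast
  next
    case (2 a b)
    have sub: "contact n \<subseteq> {a..b}"
      unfolding 2(2) by auto
    note bdd = terminal_entry_time_bounded[OF stopping_T integrable_B0 open_contact sub
        fin[unfolded exit_time_Suc] Z, folded exit_time_Suc]
    have off: "expectation (\<lambda>\<omega>. \<bar>?Z' \<omega> - x\<bar>) = C - g n x" if x: "x \<notin> contact n" for x
    proof -
      obtain k where k: "\<And>y. y \<in> closure (contact n) \<Longrightarrow> \<bar>y - x\<bar> = k * (y - x)"
        using abs_diff_eq_on_closure[OF convex_contact x] by blast
      have "expectation (\<lambda>\<omega>. \<bar>?Z' \<omega> - x\<bar>) = expectation (\<lambda>\<omega>. \<bar>?Z \<omega> - x\<bar> + k * (?Z' \<omega> - ?Z \<omega>))"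
      proof (rule cong)
        show "AE \<omega> in M. \<bar>?Z' \<omega> - x\<bar> = \<bar>?Z \<omega> - x\<bar> + k * (?Z' \<omega> - ?Z \<omega>)"
          using exit
        proof eventually_elim
          case (elim \<omega>)
          then have "?Z' \<omega> = ?Z \<omega> \<or> \<bar>?Z' \<omega> - x\<bar> = k * (?Z' \<omega> - x) \<and> \<bar>?Z \<omega> - x\<bar> = k * (?Z \<omega> - x)"
            using k by blast
          then show ?case
            by (auto simp only: right_diff_distrib)
        qed
      qed (use meas Z_meas in measurable)
      also have "\<dots> = expectation (\<lambda>\<omega>. \<bar>?Z \<omega> - x\<bar>)"
        using bdd Z by simp
      finally show ?thesis
        using pot by simp
    qed
    have "expectation (\<lambda>\<omega>. \<bar>?Z' \<omega> - x\<bar>) = C - g (Suc n) x" for x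
    proof (cases "x \<in> contact n")
      case False
      then show ?thesis
        using off[OF False] by (simp add: min_def)
    next
      case True
      then have x: "a < x" "x < b"
        unfolding 2(2) by auto
      define s where "s = (b - x) / (b - a)"
      have "s * (b - a) = b - x"
        using x by (simp add: s_def)
      then have x_eq: "x = s * a + (1 - s) * b"
        by (simp add: algebra_simps)
      have ab: "a \<notin> contact n" "b \<notin> contact n"
        unfolding 2(2) by auto
      \<comment> \<open>Seen from a point outside the interval, the distance to \<open>x\<close>
        interpolates the distances to \<open>a\<close> and \<open>b\<close> linearly.\<close>
      have "expectation (\<lambda>\<omega>. \<bar>?Z' \<omega> - x\<bar>) = expectation (\<lambda>\<omega>. s * \<bar>?Z' \<omega> - a\<bar> + (1 - s) * \<bar>?Z' \<omega> - b\<bar>)"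
      proof (rule cong)
        show "AE \<omega> in M. \<bar>?Z' \<omega> - x\<bar> = s * \<bar>?Z' \<omega> - a\<bar> + (1 - s) * \<bar>?Z' \<omega> - b\<bar>"
          using exit
        proof eventually_elim
          case (elim \<omega>)
          then have "?Z' \<omega> \<le> a \<or> b \<le> ?Z' \<omega>"
            unfolding 2(2) by auto
          then show ?case
          proof
            assume "?Z' \<omega> \<le> a"
            then have "\<bar>?Z' \<omega> - x\<bar> = x - ?Z' \<omega>" "\<bar>?Z' \<omega> - a\<bar> = a - ?Z' \<omega>" "\<bar>?Z' \<omega> - b\<bar> = b - ?Z' \<omega>"
              using x by auto
            then show ?thesis
              by (simp only: x_eq) (simp add: algebra_simps)
          next
            assume "b \<le> ?Z' \<omega>"
            then have "\<bar>?Z' \<omega> - x\<bar> = ?Z' \<omega> - x" "\<bar>?Z' \<omega> - a\<bar> = ?Z' \<omega> - a" "\<bar>?Z' \<omega> - b\<bar> = ?Z' \<omega> - b"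
              using x by auto
            then show ?thesis
              by (simp only: x_eq) (simp add: algebra_simps)
          qed
        qed
      qed (use meas in measurable)
      also have "\<dots> = s * (C - g n a) + (1 - s) * (C - g n b)"
        using bdd(1) off[OF ab(1)] off[OF ab(2)] by (subst Bochner_Integration.integral_add) auto
      also have "\<dots> = C - f (Suc n) x"
      proof -
        have "c * x = s * (c * a) + (1 - s) * (c * b)"
          by (subst x_eq) (simp add: algebra_simps)
        then show ?thesis
          unfolding 2(3)[symmetric] 2(4)[symmetric] f by (simp add: algebra_simps)
      qed
      finally show ?thesis
        using True by (simp add: min_def)
    qed
    with bdd(1) show ?thesis
      by blast
  next
    case (3 b)
    \<comment> \<open>Where the value changes, the old one is at most \<open>b\<close> and the new
      one lies in the closure but not in the half-line, hence equals \<open>b\<close>.\<close>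
    have eq: "AE \<omega> in M. ?Z' \<omega> = max (?Z \<omega>) b"
      using exit unfolding 3(1) by eventually_elim auto
    have "integrable M (\<lambda>\<omega>. max (?Z \<omega>) b)"
      using Z by (rule integrable_max) simp
    then have Z': "integrable M ?Z'"
      using integrable_cong_AE[OF meas _ eq] by auto
    \<comment> \<open>For \<open>x \<ge> b\<close> raising the value to \<open>b\<close> shortens
      the distance to \<open>x\<close> by exactly the amount raised; the constant absorbs
      this.\<close>
    define C' where "C' = C - (expectation ?Z' - expectation ?Z)"
    have off: "expectation (\<lambda>\<omega>. \<bar>?Z' \<omega> - x\<bar>) = C' - g n x" if "b \<le> x" for x
    proof -
      have "expectation (\<lambda>\<omega>. \<bar>?Z' \<omega> - x\<bar>) = expectation (\<lambda>\<omega>. \<bar>?Z \<omega> - x\<bar> - (?Z' \<omega> - ?Z \<omega>))"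
        by (rule cong) (use eq that meas Z_meas in \<open>auto elim!: eventually_mono\<close>)
      then show ?thesis
        using Z Z' pot by (simp add: C'_def)
    qed
    have "expectation (\<lambda>\<omega>. \<bar>?Z' \<omega> - x\<bar>) = C' - g (Suc n) x" for x
    proof (cases "b \<le> x")
      case True
      then have "x \<notin> contact n"
        unfolding 3(1) by simp
      then show ?thesis
        using off[OF True] by (simp add: min_def)
    next
      case False
      then have "x \<in> contact n"
        unfolding 3(1) by simp
      \<comment> \<open>The new value is at least \<open>b\<close>, so the way to
        \<open>x < b\<close> passes through \<open>b\<close>.\<close>
      have "expectation (\<lambda>\<omega>. \<bar>?Z' \<omega> - x\<bar>) = expectation (\<lambda>\<omega>. \<bar>?Z' \<omega> - b\<bar> + (b - x))"
        by (rule cong) (use eq False meas in \<open>auto elim!: eventually_mono\<close>)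
      also have "\<dots> = C' - g n b + (b - x)"
        using Z' off[of b] by (subst Bochner_Integration.integral_add) (auto simp: prob_space)
      also have "\<dots> = C' - f (Suc n) x"
        using 3(2) 3(3)[of x] by linarith
      finally show ?thesis
        using \<open>x \<in> contact n\<close> by (simp add: min_def)
    qed
    with Z' show ?thesis
      by blast
  next
    case (4 a)
    have eq: "AE \<omega> in M. ?Z' \<omega> = min (?Z \<omega>) a"
      using exit unfolding 4(1) by eventually_elim auto
    have "integrable M (\<lambda>\<omega>. min (?Z \<omega>) a)"
      using Z by (rule integrable_min) simp
    then have Z': "integrable M ?Z'"
      using integrable_cong_AE[OF meas _ eq] by auto
    \<comment> \<open>The mirror image: the value is lowered to \<open>a\<close>, so the shift of
      the mean enters with the opposite sign.\<close>
    define C' where "C' = C - (expectation ?Z - expectation ?Z')"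
    have off: "expectation (\<lambda>\<omega>. \<bar>?Z' \<omega> - x\<bar>) = C' - g n x" if "x \<le> a" for x
    proof -
      have "expectation (\<lambda>\<omega>. \<bar>?Z' \<omega> - x\<bar>) = expectation (\<lambda>\<omega>. \<bar>?Z \<omega> - x\<bar> - (?Z \<omega> - ?Z' \<omega>))"
        by (rule cong) (use eq that meas Z_meas in \<open>auto elim!: eventually_mono\<close>)
      then show ?thesis
        using Z Z' pot by (simp add: C'_def)
    qed
    have "expectation (\<lambda>\<omega>. \<bar>?Z' \<omega> - x\<bar>) = C' - g (Suc n) x" for x
    proof (cases "x \<le> a")
      case True
      then have "x \<notin> contact n"
        unfolding 4(1) by simp
      then show ?thesis
        using off[OF True] by (simp add: min_def)
    next
      case False
      then have "x \<in> contact n"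
        unfolding 4(1) by simp
      have "expectation (\<lambda>\<omega>. \<bar>?Z' \<omega> - x\<bar>) = expectation (\<lambda>\<omega>. \<bar>?Z' \<omega> - a\<bar> + (x - a))"
        by (rule cong) (use eq False meas in \<open>auto elim!: eventually_mono\<close>)
      also have "\<dots> = C' - g n a + (x - a)"
        using Z' off[of a] by (subst Bochner_Integration.integral_add) (auto simp: prob_space)
      also have "\<dots> = C' - f (Suc n) x"
        using 4(2) 4(3)[of x] by linarith
      finally show ?thesis
        using \<open>x \<in> contact n\<close> by (simp add: min_def)
    qed
    with Z' show ?thesis
      by blast
  qed
qed

text \<open>Finiteness of \<open>T_lim\<close> makes every \<open>T n\<close> finite, so the step
  can be iterated; the constant starts at 0 and may depend on \<open>n\<close>.\<close>

lemma terminal_potential: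
  assumes fin: "AE \<omega> in M. T_lim \<omega> < \<infinity>"
  shows "integrable M (terminal (T n)) \<and>
    (\<exists>C. \<forall>x. expectation (\<lambda>\<omega>. \<bar>terminal (T n) \<omega> - x\<bar>) = C - g n x)"
proof (induction n)
  case 0
  have "terminal (T 0) = B 0"
    by (simp add: terminal_def[abs_def])
  then show ?case
    using integrable_B0 by (auto simp: u_def intro!: exI[of _ 0])
next
  case (Suc n)
  have "AE \<omega> in M. T (Suc n) \<omega> < \<infinity>"
    using fin AE_space by eventually_elim (use T_le_lim le_less_trans in blast)
  then show ?case
    using Suc terminal_step[of n] by blast
qed

text \<open>Working with differences of distances gives integrands bounded by \<open>h\<close>, so
  almost sure convergence of the values suffices to pass to the limit.\<close>

lemma distr_terminal_T_lim:
  assumes \<mu>: "real_distribution \<mu>" "integrable \<mu> (\<lambda>y. y)"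
    and lim: "\<And>x. (\<lambda>n. g n x) \<longlonglongrightarrow> - (\<integral>y. \<bar>y - x\<bar> \<partial>\<mu>) - C"
    and fin: "AE \<omega> in M. T_lim \<omega> < \<infinity>"
  shows "distr M borel (terminal T_lim) = \<mu>"
proof (rule real_distribution_eqI_abs)
  have meas: "terminal T_lim \<in> borel_measurable M"
    by (rule measurable_terminal[OF measurable_T_lim T_lim_nonneg])
  show "real_distribution (distr M borel (terminal T_lim))"
    using meas by (rule real_distribution_distr)
  fix x h :: real
  assume h: "0 < h"
  let ?q = "\<lambda>y. \<bar>y - (x + h)\<bar> - \<bar>y - x\<bar>"
  have meas_n: "terminal (T n) \<in> borel_measurable M" for n
    by (rule measurable_terminal[OF stopping_measurable[OF stopping_T] T_nonneg])
  have "(\<lambda>n. expectation (\<lambda>\<omega>. ?q (terminal (T n) \<omega>))) \<longlonglongrightarrow> expectation (\<lambda>\<omega>. ?q (terminal T_lim \<omega>))"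
  proof (rule integral_dominated_convergence[where w="\<lambda>_. h"])
    show "AE \<omega> in M. (\<lambda>n. ?q (terminal (T n) \<omega>)) \<longlonglongrightarrow> ?q (terminal T_lim \<omega>)"
      using fin AE_space
    proof eventually_elim
      case (elim \<omega>)
      then have "(\<lambda>n. terminal (T n) \<omega>) \<longlonglongrightarrow> terminal T_lim \<omega>"
        unfolding terminal_def by (intro tendsto_path T_tendsto T_nonneg) auto
      then show ?case
        by (intro tendsto_intros)
    qed
    show "AE \<omega> in M. norm (?q (terminal (T n) \<omega>)) \<le> h" for n
      using h by (intro AE_I2) auto
    show "(\<lambda>\<omega>. ?q (terminal T_lim \<omega>)) \<in> borel_measurable M"
      using meas by measurable
    show "(\<lambda>\<omega>. ?q (terminal (T n) \<omega>)) \<in> borel_measurable M" for n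
      using meas_n[of n] by measurable
  qed simp
  \<comment> \<open>The constant depends on \<open>n\<close> but not on the point, so it
    cancels.\<close>
  moreover have "expectation (\<lambda>\<omega>. ?q (terminal (T n) \<omega>)) = g n x - g n (x + h)" for n
  proof -
    obtain C where "integrable M (terminal (T n))"
      and C: "\<And>x. expectation (\<lambda>\<omega>. \<bar>terminal (T n) \<omega> - x\<bar>) = C - g n x"
      using terminal_potential[OF fin, of n] by blast
    then have "expectation (\<lambda>\<omega>. ?q (terminal (T n) \<omega>)) = (C - g n (x + h)) - (C - g n x)"
      unfolding C[symmetric] by (intro Bochner_Integration.integral_diff) auto
    then show ?thesis
      by simp
  qed
  moreover have "(\<lambda>n. g n x - g n (x + h)) \<longlonglongrightarrow>
    (- (\<integral>y. \<bar>y - x\<bar> \<partial>\<mu>) - C) - (- (\<integral>y. \<bar>y - (x + h)\<bar> \<partial>\<mu>) - C)"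
    by (intro tendsto_diff lim)
  ultimately have "expectation (\<lambda>\<omega>. ?q (terminal T_lim \<omega>)) =
    (- (\<integral>y. \<bar>y - x\<bar> \<partial>\<mu>) - C) - (- (\<integral>y. \<bar>y - (x + h)\<bar> \<partial>\<mu>) - C)"
    using LIMSEQ_unique by simp
  also have "\<dots> = (\<integral>y. ?q y \<partial>\<mu>)"
  proof -
    interpret \<mu>: real_distribution \<mu>
      by (rule \<mu>(1))
    show ?thesis
      using \<mu>(2) by (subst Bochner_Integration.integral_diff) auto
  qed
  finally show "(\<integral>y. ?q y \<partial>distr M borel (terminal T_lim)) = (\<integral>y. ?q y \<partial>\<mu>)"
    using meas by (subst integral_distr) auto
qed (rule \<mu>(1))

end

section \<open>Embedding of the target law from the original hypotheses\<close>

lemma integrable_prob_ident: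
  assumes "integrable_prob \<mu>"
  shows "integrable \<mu> (\<lambda>y. y)"
proof -
  interpret real_distribution \<mu>
    using assms by (simp add: integrable_prob_def)
  show ?thesis
    using assms integrable_norm_iff[of "\<lambda>y. y" \<mu>] by (auto simp: integrable_prob_def)
qed

theorem lemma2p6:
  fixes M :: "'a measure" and B :: "real \<Rightarrow> 'a \<Rightarrow> real"
    and \<mu>0 :: "real measure" and f :: "nat \<Rightarrow> real \<Rightarrow> real"
  assumes mu0: "integrable_prob \<mu>0"
    and BM: "brownian_motion M B"
    and B0: "distr M borel (B 0) = \<mu>0"
    and affine: "\<And>n. n \<ge> 1 \<Longrightarrow> \<exists>c d. \<forall>x. f n x = c * x + d"
    and slope: "\<And>n x. n \<ge> 1 \<Longrightarrow> \<bar>deriv (f n) x\<bar> \<le> 1"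
  shows "(\<forall>\<omega>\<in>space M. incseq (\<lambda>n. exit_time B (potential \<mu>0) f n \<omega>) \<and>
            (\<lambda>n. exit_time B (potential \<mu>0) f n \<omega>) \<longlonglongrightarrow> limit_time B (potential \<mu>0) f \<omega>) \<and>
         (\<forall>\<mu> C. integrable_prob \<mu> \<longrightarrow>
            (\<forall>x. g_inf (potential \<mu>0) f x = ereal (potential \<mu> x - C)) \<longrightarrow>
            (AE \<omega> in M. limit_time B (potential \<mu>0) f \<omega> < \<infinity>) \<and>
            embeds M B (limit_time B (potential \<mu>0) f) \<mu>)"
proof -
  interpret brownian_motion M B
    by (rule BM)
  have B0_meas: "B 0 \<in> borel_measurable M"
    by (rule random_variable_B) simp
  interpret affine_exit_times M B f
  proof
    show "integrable M (B 0)"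
      by (rule integrable_distr[OF B0_meas, where f="\<lambda>y. y"]) (simp only: B0 integrable_prob_ident[OF mu0])
    fix n :: nat assume n: "1 \<le> n"
    obtain c d where f: "\<And>x. f n x = c * x + d"
      using affine[OF n] by blast
    \<comment> \<open>Existence of the derivative identifies \<open>deriv\<close> with
      \<open>c\<close>; one point is enough, as the slope is constant.\<close>
    have "(f n has_real_derivative c) (at 0)"
      unfolding f[abs_def] by (auto intro!: derivative_eq_intros)
    then have "\<bar>c\<bar> \<le> 1"
      using slope[OF n, of 0] DERIV_imp_deriv by fastforce
    with f show "\<exists>c d. \<bar>c\<bar> \<le> 1 \<and> (\<forall>x. f n x = c * x + d)"
      by blast
  qed
  have u_eq: "potential \<mu>0 = u"
  proof
    fix x
    show "potential \<mu>0 x = u x"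
      unfolding potential_def u_def B0[symmetric]
      by (subst integral_distr[OF B0_meas]) (auto simp: abs_minus_commute)
  qed
  have "(AE \<omega> in M. T_lim \<omega> < \<infinity>) \<and> embeds M B T_lim \<mu>"
    if \<mu>: "integrable_prob \<mu>" and g_inf: "\<And>x. g_inf u f x = ereal (potential \<mu> x - C)" for \<mu> C
  proof -
    note lim = g_seq_tendsto[OF g_inf]
    \<comment> \<open>A decreasing sequence stays above its limit, so the real value of
      \<open>g_inf\<close> at 0 is the required lower bound.\<close>
    have fin: "AE \<omega> in M. T_lim \<omega> < \<infinity>"
      by (rule AE_T_lim_finite[OF decseq_ge[OF g_seq_decseq lim]])
    have "distr M borel (terminal T_lim) = \<mu>"
    proof (rule distr_terminal_T_lim[OF _ _ _ fin])
      show "real_distribution \<mu>" "integrable \<mu> (\<lambda>y. y)"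
        using \<mu> integrable_prob_ident[OF \<mu>] by (simp_all add: integrable_prob_def)
      show "(\<lambda>n. g n x) \<longlonglongrightarrow> - (\<integral>y. \<bar>y - x\<bar> \<partial>\<mu>) - C" for x
        using lim[of x] by (simp add: potential_def abs_minus_commute)
    qed
    then show ?thesis
      using fin measurable_terminal[OF measurable_T_lim T_lim_nonneg]
      unfolding embeds_def terminal_def[abs_def] by blast
  qed
  then show ?thesis
    unfolding u_eq using incseq_T T_tendsto by blast
qed

end
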